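(* Let $F\colon \mathbb{R}^{2\times 2}\to[0,+\infty)$ be an isotropic, rank-one convex integrand which is positively $p$-homogeneous for some $p>1$. Suppose that either (a) $p\leq 2$ and Iwaniec's conjecture holds, i.e. the Burkholder integrand $B_q\colon\mathbb{R}^{2\times 2}\to\mathbb{R}$ is quasiconvex (at every matrix) for all $q\ge 1$; or (b) $p\geq 2$. Then $F$ is quasiconvex at every matrix $A\in \mathrm{CO}(2)$.
   Context: An integrand on $\mathbb{R}^{n\times n}$ is a Borel measurable, locally bounded function $F\colon\mathbb{R}^{n\times n}\to\mathbb{R}$. Throughout $n=2$. $F$ is quasiconvex at $A\in\mathbb{R}^{n\times n}$ if $$F(A)\leq \frac{1}{\mathscr L^n(\Omega)}\int_{\Omega} F(A+\mathrm{D}\varphi)\,dx\quad\text{for all }\varphi\in W^{1,\infty}_0(\Omega,\mathbb{R}^n),$$ where $\Omega\subset\mathbb{R}^n$ is a bounded domain (and $\mathscr L^n$ is Lebesgue measure). $F$ is rank-one convex if $t\mapsto F(A+tX)$ is convex for all $A,X\in\mathbb{R}^{n\times n}$ with $\mathrm{rank}(X)=1$. $F$ is positively $p$-homogeneous if $F(tA)=t^pF(A)$ for all $A\in\mathbb{R}^{n\times n}$ and $t>0$. $F$ is isotropic if $F(QAR)=F(A)$ for all $A\in\mathbb{R}^{n\times n}$ and all $Q,R\in \mathrm{SO}(n)$. $\mathrm{CO}(n)=\{tQ: Q\in \mathrm{O}(n),\ t\in\mathbb{R}\}$. $|A|=\max_{|\xi|=1}|A\xi|$ is the operator norm. For $n=2$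 and $q\geq n/2=1$, the Burkholder integrand is $$B_q(A)=\Big(\Big|1-\frac 2q\Big|\,|A|^2+\det A\Big)|A|^{q-2},\qquad B_q(0)=0.$$ *)

theory Defs
  imports "HOL-Analysis.Analysis"
begin

section \<open>Sobolev functions with zero boundary values\<close>

text \<open>The class \<open>C\<^sup>k\<close> on the whole space, via existence and continuity of iterated
  partial derivatives.\<close>

primrec Ck :: "nat \<Rightarrow> ('a::euclidean_space \<Rightarrow> 'b::real_normed_vector) \<Rightarrow> bool" where
  "Ck 0 f \<longleftrightarrow> continuous_on UNIV f"
| "Ck (Suc k) f \<longleftrightarrow>
     (\<forall>x. f differentiable at x) \<and> (\<forall>b\<in>Basis. Ck k (\<lambda>x. frechet_derivative f (at x) b))"

text \<open>\<open>C\<^sub>c\<^sup>\<infinity>(\<Omega>)\<close>; its elements are regarded as functions on the whole space, extended by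
  zero.\<close>

definition test_functions ::
    "'a::euclidean_space set \<Rightarrow> ('a \<Rightarrow> 'b::real_normed_vector) set" where
  "test_functions \<Omega> = {\<psi>. (\<forall>k. Ck k \<psi>) \<and>
     compact (closure {x. \<psi> x \<noteq> 0}) \<and> closure {x. \<psi> x \<noteq> 0} \<subseteq> \<Omega>}"

text \<open>\<open>D\<close> is a weak gradient of \<open>\<phi>\<close>: the entry \<open>D x $ i $ j\<close> is the weak derivative
  of the component \<open>\<phi>\<^sub>i\<close> in direction \<open>j\<close>.\<close>

definition weak_gradient ::
    "(real^'n) set \<Rightarrow> (real^'n \<Rightarrow> real^'m) \<Rightarrow> (real^'n \<Rightarrow> real^'n^'m) \<Rightarrow> bool" where
  "weak_gradient \<Omega> \<phi> D \<longleftrightarrow>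
     (\<forall>\<psi>\<in>test_functions \<Omega>. \<forall>i j.
        (\<integral>x. \<phi> x $ i * frechet_derivative \<psi> (at x) (axis j 1) \<partial>lebesgue_on \<Omega>)
          = - (\<integral>x. D x $ i $ j * \<psi> x \<partial>lebesgue_on \<Omega>))"

text \<open>\<open>L\<^sup>\<infinity>(\<Omega>)\<close>\<close>

definition Linfty :: "'a::euclidean_space set \<Rightarrow> ('a \<Rightarrow> 'b::euclidean_space) \<Rightarrow> bool" where
  "Linfty \<Omega> f \<longleftrightarrow> f \<in> borel_measurable (lebesgue_on \<Omega>) \<and>
     (\<exists>C. AE x in lebesgue_on \<Omega>. norm (f x) \<le> C)"

text \<open>The Sobolev spaces below are relations between a function \<open>\<phi>\<close> and (an arbitrary
  representative of) its weak gradient \<open>D\<close>. The space \<open>W\<^sub>0\<^sup>1\<^sup>,\<^sup>1\<close> is the closure of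
  the test functions in the \<open>W\<^sup>1\<^sup>,\<^sup>1\<close> norm, and, as is usual in the calculus of
  variations, \<open>W\<^sub>0\<^sup>1\<^sup>,\<^sup>\<infinity> = W\<^sup>1\<^sup>,\<^sup>\<infinity> \<inter> W\<^sub>0\<^sup>1\<^sup>,\<^sup>1\<close>
  (the closure of the test functions in the \<open>W\<^sup>1\<^sup>,\<^sup>\<infinity>\<close> norm would
  contain \<open>C\<^sup>1\<close> functions only).\<close>

definition W1_inf ::
    "(real^'n) set \<Rightarrow> (real^'n \<Rightarrow> real^'m) \<Rightarrow> (real^'n \<Rightarrow> real^'n^'m) \<Rightarrow> bool" where
  "W1_inf \<Omega> \<phi> D \<longleftrightarrow> Linfty \<Omega> \<phi> \<and> Linfty \<Omega> D \<and> weak_gradient \<Omega> \<phi> D"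

definition W01_1 ::
    "(real^'n) set \<Rightarrow> (real^'n \<Rightarrow> real^'m) \<Rightarrow> (real^'n \<Rightarrow> real^'n^'m) \<Rightarrow> bool" where
  "W01_1 \<Omega> \<phi> D \<longleftrightarrow>
     integrable (lebesgue_on \<Omega>) \<phi> \<and> integrable (lebesgue_on \<Omega>) D \<and>
     weak_gradient \<Omega> \<phi> D \<and>
     (\<exists>\<psi>::nat \<Rightarrow> real^'n \<Rightarrow> real^'m. (\<forall>k. \<psi> k \<in> test_functions \<Omega>) \<and>
        (\<lambda>k. (\<integral>x. norm (\<psi> k x - \<phi> x) \<partial>lebesgue_on \<Omega>)
            + (\<integral>x. norm (jacobian (\<psi> k) (at x) - D x) \<partial>lebesgue_on \<Omega>)) \<longlonglongrightarrow> 0)"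

definition W01_inf ::
    "(real^'n) set \<Rightarrow> (real^'n \<Rightarrow> real^'m) \<Rightarrow> (real^'n \<Rightarrow> real^'n^'m) \<Rightarrow> bool" where
  "W01_inf \<Omega> \<phi> D \<longleftrightarrow> W1_inf \<Omega> \<phi> D \<and> W01_1 \<Omega> \<phi> D"


section \<open>Integrands\<close>

definition bounded_domain :: "'a::euclidean_space set \<Rightarrow> bool" where
  "bounded_domain \<Omega> \<longleftrightarrow> open \<Omega> \<and> connected \<Omega> \<and> \<Omega> \<noteq> {} \<and> bounded \<Omega>"

definition integrand :: "(real^'n^'n \<Rightarrow> real) \<Rightarrow> bool" where
  "integrand F \<longleftrightarrow> F \<in> borel_measurable borel \<and> (\<forall>A. \<exists>e>0. bounded (F ` ball A e))"

text \<open>For an integrand \<open>F\<close> the function \<open>x \<mapsto> F (A + D x)\<close> is measurable and essentially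
  bounded, so the integral is a genuine one.\<close>

definition quasiconvex_at ::
    "(real^'n) set \<Rightarrow> (real^'n^'n \<Rightarrow> real) \<Rightarrow> real^'n^'n \<Rightarrow> bool" where
  "quasiconvex_at \<Omega> F A \<longleftrightarrow>
     (\<forall>\<phi> D. W01_inf \<Omega> \<phi> D \<longrightarrow>
        F A \<le> 1 / measure lebesgue \<Omega> * (\<integral>x. F (A + D x) \<partial>lebesgue_on \<Omega>))"

definition rank_one_convex :: "(real^'n^'n \<Rightarrow> real) \<Rightarrow> bool" where
  "rank_one_convex F \<longleftrightarrow>
     (\<forall>A X. rank X = 1 \<longrightarrow> convex_on UNIV (\<lambda>t. F (A + t *\<^sub>R X)))"

definition positively_homogeneous :: "real \<Rightarrow> (real^'n^'n \<Rightarrow> real) \<Rightarrow> bool" where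
  "positively_homogeneous p F \<longleftrightarrow> (\<forall>A. \<forall>t>0. F (t *\<^sub>R A) = t powr p * F A)"

definition isotropic :: "(real^'n^'n \<Rightarrow> real) \<Rightarrow> bool" where
  "isotropic F \<longleftrightarrow>
     (\<forall>A Q R. rotation_matrix Q \<longrightarrow> rotation_matrix R \<longrightarrow> F (Q ** A ** R) = F A)"

definition CO :: "(real^'n^'n) set" where
  "CO = {t *\<^sub>R Q | t Q. orthogonal_matrix Q}"

abbreviation opnorm :: "real^'n^'m \<Rightarrow> real" where
  "opnorm A \<equiv> onorm ((*v) A)"

definition burkholder :: "real \<Rightarrow> real^2^2 \<Rightarrow> real" where
  "burkholder q A = (if A = 0 then 0
     else (\<bar>1 - 2 / q\<bar> * (opnorm A)\<^sup>2 + det A) * opnorm A powr (q - 2))"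

end

theory Submission
  imports Defs
begin

text \<open>Isotropy, homogeneity and rank-one convexity bound \<open>F\<close> from below by
  a nonnegative multiple of a quasiconvex function \<open>G\<close>, with equality at a given conformal
  matrix of positive determinant. If \<open>p \<ge> 2\<close>, shearing a matrix of positive determinant to a conformal one
  of the same determinant decreases \<open>F\<close>, so that \<open>F(A) \<ge> F(I) (det A)\<^sub>+\<close>
  to the power \<open>p/2\<close>, and \<open>G\<close> is a tangent affine function of the null Lagrangian
  \<open>det\<close>. If \<open>p \<le> 2\<close>, the convex function \<open>t \<mapsto> F(diag(1, t))\<close> lies above a
  supporting line of slope \<open>p/2 F(I)\<close> at \<open>t = 1\<close>, which by homogeneity says that
  \<open>G = p/2 B\<^sub>p\<close> works. Conformal matrices of negative determinant are reduced to these
  by composing with a reflection.\<close>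

section \<open>Test functions\<close>

text \<open>Two comparison functions are needed because the lower bound along positive determinants
  behaves like det^(p/2): for p >= 2 this is convex in det and lies above its tangents, while for p
  < 2 it is concave and a tangent lies on the wrong side. The slope p/2 F(I) is forced: swapping the
  diagonal entries and rescaling gives g(t) = t^p g(1/t) for g(t) = F(diag(1, t)), and
  differentiating at 1 gives 2 g'(1) = p g(1). If g has a corner at 1, then p/2 g(1) is the mean of
  the two one-sided derivatives and still a supporting slope. Both comparison functions see
  orientation through det, so equality generally fails at conformal matrices of negative
  determinant; this is why a reflection has to be moved into F. Admissible fields have only weak
  gradients, so that the mean of det(A + D) is det A must be derived by smooth approximation, which
  is what the calculus of test functions is for.\<close>

lemma frechet_derivative_has_field_derivative:
  fixes f :: "'a::real_normed_vector \<Rightarrow> real"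
  assumes "f differentiable at (y + s *\<^sub>R v)"
  shows "((\<lambda>s. f (y + s *\<^sub>R v)) has_field_derivative frechet_derivative f (at (y + s *\<^sub>R v)) v) (at s)"
proof -
  let ?L = "frechet_derivative f (at (y + s *\<^sub>R v))"
  have 1: "(f has_derivative ?L) (at (y + s *\<^sub>R v))"
    using assms by (simp add: frechet_derivative_works)
  have 2: "((\<lambda>s. y + s *\<^sub>R v) has_derivative (\<lambda>h. h *\<^sub>R v)) (at s)"
    by (auto intro!: derivative_eq_intros)
  have "((\<lambda>s. f (y + s *\<^sub>R v)) has_derivative (\<lambda>h. ?L (h *\<^sub>R v))) (at s)"
    using diff_chain_at[OF 2 1] by (simp add: o_def)
  moreover have "(\<lambda>h. ?L (h *\<^sub>R v)) = (*) (?L v)"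
    using 1 by (auto simp: has_derivative_def linear_cmul bounded_linear.linear)
  ultimately show ?thesis by (simp add: has_field_derivative_def)
qed

lemma frechet_derivative_mean_value:
  fixes f :: "'a::real_normed_vector \<Rightarrow> real"
  assumes "\<And>x. f differentiable at x" and "0 < h"
  shows "\<exists>s. 0 < s \<and> s < h \<and>
    f (y + h *\<^sub>R v) - f y = h * frechet_derivative f (at (y + s *\<^sub>R v)) v"
  using MVT2[OF \<open>0 < h\<close>, of "\<lambda>s. f (y + s *\<^sub>R v)"
      "\<lambda>s. frechet_derivative f (at (y + s *\<^sub>R v)) v",
      OF frechet_derivative_has_field_derivative[OF assms(1)]]
  by simp

text \<open>The second difference is the increment of a function of one variable, itself a
  difference in direction \<open>w\<close>; the mean value theorem is applied first along
  \<open>v\<close>, then along \<open>w\<close>. Since the left side is symmetric in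
  \<open>v\<close> and \<open>w\<close>, two such representations can be compared.\<close>

lemma mixed_difference:
  fixes f :: "'a::real_normed_vector \<Rightarrow> real"
  assumes f: "\<And>x. f differentiable at x"
    and g: "\<And>x. (\<lambda>x. frechet_derivative f (at x) v) differentiable at x" and "0 < h"
  shows "\<exists>s t. 0 < s \<and> s < h \<and> 0 < t \<and> t < h \<and>
    f (x + h *\<^sub>R v + h *\<^sub>R w) - f (x + h *\<^sub>R w) - f (x + h *\<^sub>R v) + f x
      = h * (h * frechet_derivative (\<lambda>x. frechet_derivative f (at x) v) (at (x + s *\<^sub>R v + t *\<^sub>R w)) w)"
proof -
  let ?g = "\<lambda>x. frechet_derivative f (at x) v"
  let ?p = "\<lambda>s. f (x + h *\<^sub>R w + s *\<^sub>R v) - f (x + s *\<^sub>R v)"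
  have "(?p has_field_derivative ?g (x + h *\<^sub>R w + s *\<^sub>R v) - ?g (x + s *\<^sub>R v)) (at s)" for s
    by (intro DERIV_diff frechet_derivative_has_field_derivative f)
  from MVT2[OF \<open>0 < h\<close>, of ?p, OF this] obtain s where s: "0 < s" "s < h"
    "?p h - ?p 0 = h * (?g (x + h *\<^sub>R w + s *\<^sub>R v) - ?g (x + s *\<^sub>R v))" by auto
  obtain t where t: "0 < t" "t < h"
    "?g (x + s *\<^sub>R v + h *\<^sub>R w) - ?g (x + s *\<^sub>R v)
      = h * frechet_derivative ?g (at (x + s *\<^sub>R v + t *\<^sub>R w)) w"
    using frechet_derivative_mean_value[of ?g h "x + s *\<^sub>R v" w] g \<open>0 < h\<close> by auto
  show ?thesis
    by (rule exI[of _ s], rule exI[of _ t]) (use s t in \<open>simp add: algebra_simps\<close>)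
qed

text \<open>Schwarz's theorem, in terms of the iterated partial derivatives that \<open>Ck\<close>
  provides. Both mixed derivatives represent the same second difference at intermediate points,
  which converge to \<open>x\<close> as the step shrinks.\<close>

lemma symmetric_mixed_derivatives:
  fixes f :: "'a::real_normed_vector \<Rightarrow> real"
  assumes f: "\<And>x. f differentiable at x"
    and v: "\<And>x. (\<lambda>x. frechet_derivative f (at x) v) differentiable at x"
    and w: "\<And>x. (\<lambda>x. frechet_derivative f (at x) w) differentiable at x"
    and vw: "continuous_on UNIV (\<lambda>x. frechet_derivative (\<lambda>x. frechet_derivative f (at x) v) (at x) w)"
    and wv: "continuous_on UNIV (\<lambda>x. frechet_derivative (\<lambda>x. frechet_derivative f (at x) w) (at x) v)"
  shows "frechet_derivative (\<lambda>x. frechet_derivative f (at x) v) (at x) w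
    = frechet_derivative (\<lambda>x. frechet_derivative f (at x) w) (at x) v"
proof -
  let ?P = "\<lambda>x. frechet_derivative (\<lambda>x. frechet_derivative f (at x) v) (at x) w"
  let ?Q = "\<lambda>x. frechet_derivative (\<lambda>x. frechet_derivative f (at x) w) (at x) v"
  define h where "h n = inverse (real (Suc n))" for n
  have h0: "h n > 0" for n by (simp add: h_def)
  have hlim: "h \<longlonglongrightarrow> 0" unfolding h_def by (rule LIMSEQ_inverse_real_of_nat)
  have "\<exists>s t s' t'. 0 < s \<and> s < h n \<and> 0 < t \<and> t < h n \<and> 0 < s' \<and> s' < h n \<and> 0 < t' \<and> t' < h n \<and>
     ?P (x + s *\<^sub>R v + t *\<^sub>R w) = ?Q (x + s' *\<^sub>R w + t' *\<^sub>R v)" for n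
  proof -
    obtain s t where "0 < s" "s < h n" "0 < t" "t < h n"
      "f (x + h n *\<^sub>R v + h n *\<^sub>R w) - f (x + h n *\<^sub>R w) - f (x + h n *\<^sub>R v) + f x
        = h n * (h n * ?P (x + s *\<^sub>R v + t *\<^sub>R w))"
      using mixed_difference[OF f v h0] by blast
    moreover obtain s' t' where "0 < s'" "s' < h n" "0 < t'" "t' < h n"
      "f (x + h n *\<^sub>R w + h n *\<^sub>R v) - f (x + h n *\<^sub>R v) - f (x + h n *\<^sub>R w) + f x
        = h n * (h n * ?Q (x + s' *\<^sub>R w + t' *\<^sub>R v))"
      using mixed_difference[OF f w h0] by blast
    moreover have "f (x + h n *\<^sub>R w + h n *\<^sub>R v) = f (x + h n *\<^sub>R v + h n *\<^sub>R w)"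
      by (simp add: add_ac)
    ultimately have "h n * (h n * ?P (x + s *\<^sub>R v + t *\<^sub>R w)) = h n * (h n * ?Q (x + s' *\<^sub>R w + t' *\<^sub>R v))"
      by linarith
    then have "?P (x + s *\<^sub>R v + t *\<^sub>R w) = ?Q (x + s' *\<^sub>R w + t' *\<^sub>R v)"
      using h0[of n] by simp
    then show ?thesis
      using \<open>0 < s\<close> \<open>s < h n\<close> \<open>0 < t\<close> \<open>t < h n\<close> \<open>0 < s'\<close> \<open>s' < h n\<close> \<open>0 < t'\<close> \<open>t' < h n\<close> by blast
  qed
  then obtain s t s' t' where st: "\<And>n. 0 < s n \<and> s n < h n \<and> 0 < t n \<and> t n < h n \<and>
      0 < s' n \<and> s' n < h n \<and> 0 < t' n \<and> t' n < h n \<and>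
      ?P (x + s n *\<^sub>R v + t n *\<^sub>R w) = ?Q (x + s' n *\<^sub>R w + t' n *\<^sub>R v)"
    by metis
  have squeeze: "r \<longlonglongrightarrow> 0" if "\<And>n. 0 < r n \<and> r n < h n" for r
    by (rule tendsto_sandwich[OF _ _ tendsto_const hlim])
      (use that in \<open>auto intro!: always_eventually less_imp_le\<close>)
  have s0: "s \<longlonglongrightarrow> 0" "t \<longlonglongrightarrow> 0" "s' \<longlonglongrightarrow> 0" "t' \<longlonglongrightarrow> 0"
    using st by (auto intro!: squeeze)
  have "(\<lambda>n. x + s n *\<^sub>R v + t n *\<^sub>R w) \<longlonglongrightarrow> x + 0 *\<^sub>R v + 0 *\<^sub>R w"
    by (intro tendsto_intros s0)
  then have "(\<lambda>n. ?P (x + s n *\<^sub>R v + t n *\<^sub>R w)) \<longlonglongrightarrow> ?P x"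
    using continuous_on_tendsto_compose[OF vw, of "\<lambda>n. x + s n *\<^sub>R v + t n *\<^sub>R w"] by simp
  moreover have "(\<lambda>n. x + s' n *\<^sub>R w + t' n *\<^sub>R v) \<longlonglongrightarrow> x + 0 *\<^sub>R w + 0 *\<^sub>R v"
    by (intro tendsto_intros s0)
  then have "(\<lambda>n. ?Q (x + s' n *\<^sub>R w + t' n *\<^sub>R v)) \<longlonglongrightarrow> ?Q x"
    using continuous_on_tendsto_compose[OF wv, of "\<lambda>n. x + s' n *\<^sub>R w + t' n *\<^sub>R v"] by simp
  moreover have "(\<lambda>n. ?P (x + s n *\<^sub>R v + t n *\<^sub>R w)) = (\<lambda>n. ?Q (x + s' n *\<^sub>R w + t' n *\<^sub>R v))"
    using st by (intro ext) simp
  ultimately show ?thesis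
    by (auto intro: LIMSEQ_unique)
qed

section \<open>Closure properties and integrability of test functions\<close>

lemma frechet_derivative_bounded_linear_compose:
  assumes "bounded_linear L" "f differentiable at x"
  shows "frechet_derivative (\<lambda>x. L (f x)) (at x) = (\<lambda>h. L (frechet_derivative f (at x) h))"
  using assms
  by (metis bounded_linear.has_derivative frechet_derivative_at frechet_derivative_works)

lemma Ck_bounded_linear_compose:
  assumes "bounded_linear L" "Ck k f"
  shows "Ck k (\<lambda>x. L (f x))"
  using assms(2)
proof (induction k arbitrary: f)
  case 0
  then show ?case using assms(1) by (auto intro: bounded_linear.continuous_on)
next
  case (Suc k)
  have *: "f differentiable at x" for x using Suc.prems by simp
  have "(\<lambda>x. L (f x)) differentiable at x" for x
    using *[of x] assms(1) unfolding differentiable_def by (metis bounded_linear.has_derivative)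
  then show ?case
    using Suc by (simp add: frechet_derivative_bounded_linear_compose[OF assms(1) *])
qed

text \<open>Serves both linear images and partial derivatives of a test function: neither enlarges
  the support, so only smoothness is left to check.\<close>

lemma test_functions_subset_support:
  assumes "\<psi> \<in> test_functions \<Omega>" "\<And>k. Ck k f"
    and "{x. f x \<noteq> 0} \<subseteq> closure {x. \<psi> x \<noteq> 0}"
  shows "f \<in> test_functions \<Omega>"
proof -
  have "closure {x. f x \<noteq> 0} \<subseteq> closure {x. \<psi> x \<noteq> 0}"
    using assms(3) by (simp add: closure_minimal)
  moreover have "compact (closure {x. \<psi> x \<noteq> 0})" "closure {x. \<psi> x \<noteq> 0} \<subseteq> \<Omega>"
    using assms(1) unfolding test_functions_def by auto
  moreover from calculation have "compact (closure {x. f x \<noteq> 0})"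
    using compact_Int_closed[OF _ closed_closure, of "closure {x. \<psi> x \<noteq> 0}" "{x. f x \<noteq> 0}"]
    by (metis Int_absorb1)
  ultimately have "(\<forall>k. Ck k f) \<and> compact (closure {x. f x \<noteq> 0}) \<and> closure {x. f x \<noteq> 0} \<subseteq> \<Omega>"
    using assms(2) by (intro conjI) auto
  then show ?thesis
    unfolding test_functions_def mem_Collect_eq .
qed

lemma test_functions_bounded_linear_compose:
  assumes "bounded_linear L" "\<psi> \<in> test_functions \<Omega>"
  shows "(\<lambda>x. L (\<psi> x)) \<in> test_functions \<Omega>"
proof (rule test_functions_subset_support[OF assms(2)])
  show "Ck k (\<lambda>x. L (\<psi> x))" for k
    using assms Ck_bounded_linear_compose unfolding test_functions_def by blast
  have "{x. L (\<psi> x) \<noteq> 0} \<subseteq> {x. \<psi> x \<noteq> 0}"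
    using assms(1) by (auto simp: linear_0 bounded_linear.linear)
  then show "{x. L (\<psi> x) \<noteq> 0} \<subseteq> closure {x. \<psi> x \<noteq> 0}"
    using closure_subset by (rule subset_trans)
qed

lemma test_functions_differentiable:
  assumes "\<psi> \<in> test_functions \<Omega>"
  shows "\<psi> differentiable at x"
proof -
  have "Ck (Suc 0) \<psi>" using assms unfolding test_functions_def by blast
  then show ?thesis by simp
qed

lemma test_functions_continuous:
  "\<psi> \<in> test_functions \<Omega> \<Longrightarrow> continuous_on UNIV \<psi>"
  unfolding test_functions_def by (metis (mono_tags, lifting) Ck.simps(1) mem_Collect_eq)

lemma test_functions_frechet_derivative:
  assumes "\<psi> \<in> test_functions \<Omega>" "b \<in> Basis"
  shows "(\<lambda>x. frechet_derivative \<psi> (at x) b) \<in> test_functions \<Omega>"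
proof -
  have ck: "Ck k (\<lambda>x. frechet_derivative \<psi> (at x) b)" for k
  proof -
    have "Ck (Suc k) \<psi>" using assms unfolding test_functions_def by blast
    then show ?thesis using assms by simp
  qed
  have "frechet_derivative \<psi> (at x) b = 0" if "x \<notin> closure {x. \<psi> x \<noteq> 0}" for x
  proof -
    have "((\<lambda>x. 0) has_derivative (\<lambda>h. 0)) (at x)" by simp
    then have "(\<psi> has_derivative (\<lambda>h. 0)) (at x)"
      by (rule has_derivative_transform_within_open[of _ _ _ _ "- closure {x. \<psi> x \<noteq> 0}"])
        (use that closure_subset[of "{x. \<psi> x \<noteq> 0}"] in auto)
    then show ?thesis by (metis frechet_derivative_at)
  qed
  then show ?thesis
    by (intro test_functions_subset_support[OF assms(1)] ck) auto
qed

lemma test_functions_zero_outside: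
  "\<psi> \<in> test_functions \<Omega> \<Longrightarrow> x \<notin> \<Omega> \<Longrightarrow> \<psi> x = 0"
  unfolding test_functions_def using closure_subset[of "{x. \<psi> x \<noteq> 0}"] by blast

lemma test_functions_dominated:
  assumes "\<psi> \<in> test_functions \<Omega>"
  shows "\<exists>K M. compact K \<and> 0 \<le> M \<and> (\<forall>x. x \<notin> K \<longrightarrow> \<psi> x = 0) \<and> (\<forall>x. norm (\<psi> x) \<le> M)"
proof -
  define K where "K = closure {x. \<psi> x \<noteq> 0}"
  have K: "compact K" "\<And>x. x \<notin> K \<Longrightarrow> \<psi> x = 0"
    using assms closure_subset[of "{x. \<psi> x \<noteq> 0}"] unfolding test_functions_def K_def by auto
  have "compact (\<psi> ` K)"
    using K test_functions_continuous[OF assms] continuous_on_subset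
    by (blast intro: compact_continuous_image)
  then obtain M where M: "M > 0" "\<forall>y\<in>\<psi> ` K. norm y \<le> M"
    using compact_imp_bounded bounded_pos by metis
  then have "norm (\<psi> x) \<le> M" for x
    using K(2)[of x] by (cases "x \<in> K") auto
  then show ?thesis using K M(1) less_imp_le by blast
qed

lemma test_functions_integrable:
  fixes \<psi> :: "'a::euclidean_space \<Rightarrow> 'b::euclidean_space"
  assumes "\<psi> \<in> test_functions \<Omega>"
  shows "integrable lborel \<psi>"
proof -
  obtain K M where K: "compact K" "0 \<le> M" "\<And>x. x \<notin> K \<Longrightarrow> \<psi> x = 0" "\<And>x. norm (\<psi> x) \<le> M"
    using test_functions_dominated[OF assms] by blast
  have "set_integrable lborel K \<psi>"
    using borel_integrable_compact[OF K(1)] test_functions_continuous[OF assms]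
    unfolding set_integrable_def by (metis continuous_on_subset subset_UNIV)
  moreover have "(\<lambda>x. indicator K x *\<^sub>R \<psi> x) = \<psi>"
    using K(3) by (auto simp: indicator_def)
  ultimately show ?thesis unfolding set_integrable_def by simp
qed

text \<open>Translation invariance is available on \<open>lborel\<close>, whereas the Sobolev
  definitions integrate over \<open>lebesgue_on \<Omega>\<close>. Extension by zero makes the two
  integrals agree.\<close>

lemma test_functions_lebesgue_on:
  fixes \<psi> :: "'a::euclidean_space \<Rightarrow> 'b::euclidean_space"
  assumes "\<psi> \<in> test_functions \<Omega>" "open \<Omega>"
  shows "integrable (lebesgue_on \<Omega>) \<psi>"
    and "integral\<^sup>L (lebesgue_on \<Omega>) \<psi> = integral\<^sup>L lborel \<psi>"
proof -
  have 1: "(\<lambda>x. indicator \<Omega> x *\<^sub>R \<psi> x) = \<psi>"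
    using test_functions_zero_outside[OF assms(1)] by (auto simp: indicator_def)
  have 2: "\<Omega> \<inter> space lebesgue \<in> sets lebesgue" using assms(2) by auto
  have 3: "\<psi> \<in> borel_measurable lborel"
    using test_functions_integrable[OF assms(1)] by auto
  show "integrable (lebesgue_on \<Omega>) \<psi>"
    using integrable_restrict_space[OF 2, of \<psi>] integrable_completion[OF 3]
      test_functions_integrable[OF assms(1)] unfolding set_integrable_def 1 by metis
  show "integral\<^sup>L (lebesgue_on \<Omega>) \<psi> = integral\<^sup>L lborel \<psi>"
    using integral_restrict_space[OF 2, of \<psi>] integral_completion[OF 3]
    unfolding set_lebesgue_integral_def 1 by metis
qed

lemma integral_lborel_translation:
  fixes f :: "'a::euclidean_space \<Rightarrow> 'b::euclidean_space"
  assumes "f \<in> borel_measurable borel"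
  shows "(\<integral>x. f (c + x) \<partial>lborel) = integral\<^sup>L lborel f"
  using integral_distr[of "(+) c" lborel borel f] assms by (simp add: lborel_distr_plus)

lemma integrable_lborel_translation:
  fixes f :: "'a::euclidean_space \<Rightarrow> 'b::euclidean_space"
  assumes "integrable lborel f"
  shows "integrable lborel (\<lambda>x. f (c + x))"
  using integrable_distr_eq[of "(+) c" lborel borel f] assms by (simp add: lborel_distr_plus)

text \<open>By translation invariance all difference quotients have integral zero.\<close>

lemma test_functions_integral_derivative_lborel:
  fixes \<psi> :: "'a::euclidean_space \<Rightarrow> real"
  assumes psi: "\<psi> \<in> test_functions \<Omega>" and b: "b \<in> Basis"
  shows "(\<integral>x. frechet_derivative \<psi> (at x) b \<partial>lborel) = 0"
proof -
  define h where "h n = inverse (real (Suc n))" for n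
  have h0: "h n > 0" "h n \<le> 1" for n
    using le_imp_inverse_le[of 1 "real (Suc n)"] by (simp_all add: h_def)
  have hlim: "h \<longlonglongrightarrow> 0" unfolding h_def by (rule LIMSEQ_inverse_real_of_nat)
  let ?d = "\<lambda>x. frechet_derivative \<psi> (at x) b"
  let ?q = "\<lambda>n x. (\<psi> (h n *\<^sub>R b + x) - \<psi> x) / h n"
  note dtest = test_functions_frechet_derivative[OF psi b]
  obtain K M where K: "compact K" "0 \<le> M" "\<And>x. x \<notin> K \<Longrightarrow> ?d x = 0" "\<And>x. norm (?d x) \<le> M"
    using test_functions_dominated[OF dtest] by blast
  obtain R where R: "\<And>x. x \<in> K \<Longrightarrow> norm x \<le> R"
    using compact_imp_bounded[OF K(1)] bounded_iff by metis
  have int: "integrable lborel \<psi>" by (rule test_functions_integrable[OF psi])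
  have zero: "integral\<^sup>L lborel (?q n) = 0" for n
    using integrable_lborel_translation[OF int] integral_lborel_translation[of \<psi>] int by simp
  have q: "\<exists>s. 0 < s \<and> s < h n \<and> ?q n x = ?d (x + s *\<^sub>R b)" for n x
    using frechet_derivative_mean_value[of \<psi> "h n" x b] test_functions_differentiable[OF psi] h0[of n]
    by (auto simp: add.commute)
  have "(\<lambda>n. integral\<^sup>L lborel (?q n)) \<longlonglongrightarrow> integral\<^sup>L lborel ?d"
  \<comment> \<open>Each quotient is a value of the derivative at a point within distance 1 of
    \<open>x\<close>, because \<open>h n\<close> is at most 1 and \<open>b\<close> is a unit vector.
    Hence it is bounded by \<open>M\<close> and vanishes once \<open>x\<close> leaves the ball of
    radius \<open>R + 1\<close>.\<close>
  proof (rule integral_dominated_convergence[where w="\<lambda>x. indicator (cball 0 (R + 1)) x *\<^sub>R M"])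
    show "?d \<in> borel_measurable lborel" using test_functions_integrable[OF dtest] by simp
    show "?q n \<in> borel_measurable lborel" for n
      using integrable_lborel_translation[OF int] int by simp
    show "integrable lborel (\<lambda>x::'a. indicator (cball 0 (R + 1)) x *\<^sub>R M)"
      using borel_integrable_compact[of "cball (0::'a) (R + 1)" "\<lambda>_. M"] by auto
    have "(\<lambda>n. ?q n x) \<longlonglongrightarrow> ?d x" for x
    proof -
      obtain s where s: "\<And>n. 0 < s n \<and> s n < h n \<and> ?q n x = ?d (x + s n *\<^sub>R b)"
        using q[of _ x] by metis
      have "s \<longlonglongrightarrow> 0"
        by (rule tendsto_sandwich[OF _ _ tendsto_const hlim])
          (use s in \<open>auto intro!: always_eventually less_imp_le\<close>)
      then have "(\<lambda>n. x + s n *\<^sub>R b) \<longlonglongrightarrow> x + 0 *\<^sub>R b" by (intro tendsto_intros)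
      then have "(\<lambda>n. ?d (x + s n *\<^sub>R b)) \<longlonglongrightarrow> ?d x"
        using continuous_on_tendsto_compose[OF test_functions_continuous[OF dtest],
            of "\<lambda>n. x + s n *\<^sub>R b"] by simp
      then show ?thesis using s by presburger
    qed
    then show "AE x in lborel. (\<lambda>n. ?q n x) \<longlonglongrightarrow> ?d x" by simp
    have "norm (?q n x) \<le> indicator (cball 0 (R + 1)) x *\<^sub>R M" for n x
    proof -
      obtain s where s: "0 < s" "s < h n" "?q n x = ?d (x + s *\<^sub>R b)" using q by blast
      show ?thesis
      proof (cases "x \<in> cball 0 (R + 1)")
        case True
        then show ?thesis using s(3) K(4) by simp
      next
        case False
        have "norm x \<le> norm (x + s *\<^sub>R b) + norm (s *\<^sub>R b)"
          using norm_triangle_ineq4[of "x + s *\<^sub>R b" "s *\<^sub>R b"] by simp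
        then have "norm (x + s *\<^sub>R b) > R" using False s h0[of n] b by simp
        then have "x + s *\<^sub>R b \<notin> K" using R by force
        then show ?thesis using s(3) K(2,3) False by simp
      qed
    qed
    then show "AE x in lborel. norm (?q n x) \<le> indicator (cball 0 (R + 1)) x *\<^sub>R M" for n by simp
  qed
  then show ?thesis unfolding zero using LIMSEQ_unique tendsto_const by metis
qed

section \<open>Isotropic functions of real two by two matrices\<close>

definition mat2 :: "real \<Rightarrow> real \<Rightarrow> real \<Rightarrow> real \<Rightarrow> real^2^2" where
  "mat2 a b c d = vector [vector [a, b], vector [c, d]]"

lemma mat2_nth [simp]:
  "mat2 a b c d $ 1 $ 1 = a" "mat2 a b c d $ 1 $ 2 = b"
  "mat2 a b c d $ 2 $ 1 = c" "mat2 a b c d $ 2 $ 2 = d"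
  by (simp_all add: mat2_def)

lemma mat2_eq_iff:
  "A = B \<longleftrightarrow> A$1$1 = B$1$1 \<and> A$1$2 = B$1$2 \<and> A$2$1 = B$2$1 \<and> A$2$2 = (B::real^2^2)$2$2"
  by (auto simp: vec_eq_iff forall_2)

lemma mat2_mult: "mat2 a b c d ** mat2 a' b' c' d' =
    mat2 (a * a' + b * c') (a * b' + b * d') (c * a' + d * c') (c * b' + d * d')"
  by (simp add: mat2_eq_iff matrix_matrix_mult_def sum_2)

lemma mat2_scaleR: "t *\<^sub>R mat2 a b c d = mat2 (t * a) (t * b) (t * c) (t * d)"
  by (simp add: mat2_eq_iff)

lemma mat2_add: "mat2 a b c d + mat2 a' b' c' d' = mat2 (a + a') (b + b') (c + c') (d + d')"
  by (simp add: mat2_eq_iff)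

lemma mat2_mat: "mat k = mat2 k 0 0 k"
  by (simp add: mat2_eq_iff mat_def)

definition rot2 :: "real \<Rightarrow> real^2^2" where
  "rot2 \<theta> = mat2 (cos \<theta>) (- sin \<theta>) (sin \<theta>) (cos \<theta>)"

lemma transpose_mat2: "transpose (mat2 a b c d) = mat2 a c b d"
  by (simp add: mat2_eq_iff transpose_def)

lemma rotation_matrix_rot2: "rotation_matrix (rot2 \<theta>)"
  using sin_cos_squared_add[of \<theta>] unfolding rotation_matrix_def orthogonal_matrix rot2_def transpose_mat2
  by (simp add: mat2_mult mat2_mat det_2 power2_eq_square algebra_simps)

text \<open>The linear map \<open>z \<mapsto> \<alpha> z + \<beta> z\<^sup>*\<close> of the complex plane has the
  singular values \<open>\<bar>\<alpha>\<bar> + \<bar>\<beta>\<bar>\<close> and \<open>\<bar>\<bar>\<alpha>\<bar> - \<bar>\<beta>\<bar>\<bar>\<close>.\<close>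

definition conformal_norm :: "real^2^2 \<Rightarrow> real" where
  "conformal_norm A = sqrt ((A$1$1 + A$2$2)\<^sup>2 + (A$2$1 - A$1$2)\<^sup>2) / 2"

definition anticonformal_norm :: "real^2^2 \<Rightarrow> real" where
  "anticonformal_norm A = sqrt ((A$1$1 - A$2$2)\<^sup>2 + (A$1$2 + A$2$1)\<^sup>2) / 2"

lemma conformal_norm_nonneg: "0 \<le> conformal_norm A" "0 \<le> anticonformal_norm A"
  by (simp_all add: conformal_norm_def anticonformal_norm_def)

lemma conformal_norm_squared:
  "(conformal_norm A)\<^sup>2 = ((A$1$1 + A$2$2)\<^sup>2 + (A$2$1 - A$1$2)\<^sup>2) / 4"
  "(anticonformal_norm A)\<^sup>2 = ((A$1$1 - A$2$2)\<^sup>2 + (A$1$2 + A$2$1)\<^sup>2) / 4"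
  by (simp_all add: conformal_norm_def anticonformal_norm_def power_divide)

lemma det_conformal: "det A = (conformal_norm A)\<^sup>2 - (anticonformal_norm A)\<^sup>2"
  unfolding conformal_norm_squared by (simp add: det_2 power2_eq_square field_simps)

lemma polar_nonneg: "\<exists>t. x = sqrt (x\<^sup>2 + y\<^sup>2) * cos t \<and> y = sqrt (x\<^sup>2 + y\<^sup>2) * sin t"
proof -
  have "Complex x y = rcis (sqrt (x\<^sup>2 + y\<^sup>2)) (Arg (Complex x y))"
    using rcis_cmod_Arg[of "Complex x y"] by (simp add: cmod_def)
  then show ?thesis
    by (metis Re_rcis Im_rcis complex.sel)
qed

text \<open>The diagonal factor is the map z -> u z + v z* on complex numbers. Rotating by \<phi>
  before and \<theta> after gives the two coefficients the arguments \<theta> + \<phi> and \<theta>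
  - \<phi>, so the half-sum and half-difference of the given arguments are the right angles. The
  second entry carries the sign of the determinant, since both outer factors are proper
  rotations.\<close>

lemma signed_singular_values:
  fixes A :: "real^2^2"
  defines "u \<equiv> conformal_norm A" and "v \<equiv> anticonformal_norm A"
  shows "\<exists>\<theta> \<phi>. A = rot2 \<theta> ** mat2 (u + v) 0 0 (u - v) ** rot2 \<phi>"
proof -
  obtain \<alpha> where \<alpha>: "A$1$1 + A$2$2 = 2 * u * cos \<alpha>" "A$2$1 - A$1$2 = 2 * u * sin \<alpha>"
    using polar_nonneg[of "A$1$1 + A$2$2" "A$2$1 - A$1$2"] unfolding u_def conformal_norm_def by auto
  obtain \<beta> where \<beta>: "A$1$1 - A$2$2 = 2 * v * cos \<beta>" "A$1$2 + A$2$1 = 2 * v * sin \<beta>"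
    using polar_nonneg[of "A$1$1 - A$2$2" "A$1$2 + A$2$1"] unfolding v_def anticonformal_norm_def by auto
  define \<theta> \<phi> where "\<theta> = (\<alpha> + \<beta>) / 2" and "\<phi> = (\<alpha> - \<beta>) / 2"
  have "\<alpha> = \<theta> + \<phi>" "\<beta> = \<theta> - \<phi>" by (simp_all add: \<theta>_def \<phi>_def field_simps)
  with \<alpha> \<beta> have e:
    "A$1$1 + A$2$2 = 2 * u * (cos \<theta> * cos \<phi> - sin \<theta> * sin \<phi>)"
    "A$2$1 - A$1$2 = 2 * u * (sin \<theta> * cos \<phi> + cos \<theta> * sin \<phi>)"
    "A$1$1 - A$2$2 = 2 * v * (cos \<theta> * cos \<phi> + sin \<theta> * sin \<phi>)"
    "A$1$2 + A$2$1 = 2 * v * (sin \<theta> * cos \<phi> - cos \<theta> * sin \<phi>)"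
    by (simp_all add: cos_add sin_add cos_diff sin_diff)
  have "A = rot2 \<theta> ** mat2 (u + v) 0 0 (u - v) ** rot2 \<phi>"
    unfolding rot2_def mat2_mult unfolding mat2_eq_iff mat2_nth
    using e by (simp add: algebra_simps)
  then show ?thesis by blast
qed

lemma isotropic_diagonal:
  assumes "isotropic F"
  shows "F A = F (mat2 (conformal_norm A + anticonformal_norm A) 0 0
    (conformal_norm A - anticonformal_norm A))"
  using signed_singular_values[of A] assms rotation_matrix_rot2 unfolding isotropic_def by metis

lemma isotropic_cong:
  assumes "isotropic F" "conformal_norm A = conformal_norm B"
    "anticonformal_norm A = anticonformal_norm B"
  shows "F A = F B"
  using isotropic_diagonal[OF assms(1), of A] isotropic_diagonal[OF assms(1), of B] assms(2,3) by simp

lemma norm_rotation: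
  fixes Q :: "real^'n^'n"
  assumes "rotation_matrix Q"
  shows "norm (Q *v x) = norm x"
proof -
  have "orthogonal_transformation ((*v) Q)"
    using assms orthogonal_transformation_matrix[of "(*v) Q"] unfolding rotation_matrix_def by simp
  then show ?thesis by (simp add: orthogonal_transformation_norm)
qed

text \<open>Rotations preserve length, so only the diagonal factor counts, and its first entry
  dominates the second in modulus. This puts the Burkholder integrand into the same two coordinates
  as an isotropic function.\<close>

lemma opnorm_conformal: "opnorm A = conformal_norm A + anticonformal_norm A"
proof -
  let ?x = "conformal_norm A + anticonformal_norm A" and ?y = "conformal_norm A - anticonformal_norm A"
  have xy: "\<bar>?y\<bar> \<le> ?x" "0 \<le> ?x" using conformal_norm_nonneg[of A] by auto
  obtain \<theta> \<phi> where A: "A = rot2 \<theta> ** mat2 ?x 0 0 ?y ** rot2 \<phi>"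
    using signed_singular_values by blast
  have nv: "norm v = sqrt ((v$1)\<^sup>2 + (v$2)\<^sup>2)" for v :: "real^2"
    by (simp add: norm_vec_def L2_set_def sum_2)
  have d: "norm (mat2 ?x 0 0 ?y *v v) = sqrt ((?x * v$1)\<^sup>2 + (?y * v$2)\<^sup>2)" for v
    by (simp add: nv matrix_vector_mult_def sum_2)
  have n: "norm (A *v w) = norm (mat2 ?x 0 0 ?y *v (rot2 \<phi> *v w))" for w
    by (subst A) (simp add: norm_rotation[OF rotation_matrix_rot2] flip: matrix_vector_mul_assoc)
  have le: "norm (A *v w) \<le> ?x * norm w" for w
  proof -
    have "(?y * v)\<^sup>2 \<le> (?x * v)\<^sup>2" for v
      using xy by (auto simp: power_mult_distrib abs_le_square_iff[symmetric] intro!: mult_right_mono)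
    then have "norm (A *v w) \<le> sqrt ((?x * (rot2 \<phi> *v w)$1)\<^sup>2 + (?x * (rot2 \<phi> *v w)$2)\<^sup>2)"
      unfolding n d by simp
    also have "\<dots> = ?x * norm (rot2 \<phi> *v w)"
      unfolding nv using xy(2)
      by (simp add: power_mult_distrib real_sqrt_mult flip: distrib_left)
    finally show ?thesis by (simp add: norm_rotation[OF rotation_matrix_rot2])
  qed
  \<comment> \<open>A maximiser: the inner rotation carries this unit vector to the first axis,
    which the diagonal factor stretches most.\<close>
  define w where "w = transpose (rot2 \<phi>) *v axis 1 1"
  have "rot2 \<phi> ** transpose (rot2 \<phi>) = mat 1"
    using rotation_matrix_rot2[of \<phi>] unfolding rotation_matrix_def orthogonal_matrix_def by simp
  then have w: "rot2 \<phi> *v w = axis 1 1"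
    unfolding w_def matrix_vector_mul_assoc by simp
  then have "norm w = 1" using norm_rotation[OF rotation_matrix_rot2, of \<phi> w] by simp
  moreover have "norm (A *v w) = ?x" unfolding n w d using xy(2) by (simp add: axis_def)
  ultimately have "?x \<le> opnorm A"
    using onorm[of "(*v) A" w] by simp
  moreover have "opnorm A \<le> ?x" using le by (intro onorm_le) auto
  ultimately show ?thesis by simp
qed

section \<open>Pointwise lower bounds for isotropic rank-one convex functions\<close>

lemma rank_mat2_one:
  assumes "A \<noteq> 0" "det A = 0"
  shows "rank (A::real^2^2) = 1"
proof -
  have "rank A \<noteq> 2" using assms(2) det_eq_0_rank[of A] by simp
  moreover have "rank A \<le> 2" using rank_bound[of A] by simp
  moreover have "rank A \<noteq> 0" using assms(1) by (simp add: rank_eq_0)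
  ultimately show ?thesis by linarith
qed

text \<open>The two shears of the conformal matrix \<open>\<surd>(det A) I\<close> by \<open>\<plusminus>2v\<close> have the same
  signed singular values as \<open>A\<close>.\<close>

lemma rank_one_convex_ge_conformal:
  fixes F :: "real^2^2 \<Rightarrow> real"
  assumes iso: "isotropic F" and roc: "rank_one_convex F" and "0 < det A"
  shows "F (mat (sqrt (det A))) \<le> F A"
proof -
  let ?u = "conformal_norm A" and ?v = "anticonformal_norm A" and ?s = "sqrt (det A)"
  \<comment> \<open>The shear has determinant \<open>det A\<close> and anticonformal norm half of
    \<open>\<bar>t\<bar>\<close>; these two numbers determine its conformal norm.\<close>
  have shear: "F (mat ?s + t *\<^sub>R mat2 0 1 0 0) = F A" if "\<bar>t\<bar> = 2 * ?v" for t
  proof (rule isotropic_cong[OF iso])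
    have "t\<^sup>2 = 4 * ?v\<^sup>2" using that by (metis power2_abs power_mult_distrib four_x_squared)
    moreover have "?s\<^sup>2 = ?u\<^sup>2 - ?v\<^sup>2"
      using real_sqrt_pow2[of "det A"] assms(3) unfolding det_conformal[of A] by simp
    ultimately have "(?s + ?s)\<^sup>2 + (0 - t)\<^sup>2 = (2 * ?u)\<^sup>2"
      unfolding mult_2[symmetric] power_mult_distrib by simp
    then show "conformal_norm (mat ?s + t *\<^sub>R mat2 0 1 0 0) = ?u"
      unfolding mat2_mat mat2_scaleR mat2_add conformal_norm_def[of "mat2 _ _ _ _"]
      using conformal_norm_nonneg[of A] by (simp add: real_sqrt_mult)
    show "anticonformal_norm (mat ?s + t *\<^sub>R mat2 0 1 0 0) = ?v"
      unfolding mat2_mat mat2_scaleR mat2_add anticonformal_norm_def[of "mat2 _ _ _ _"]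
      using that by simp
  qed
  have "rank (mat2 0 1 0 0) = 1" by (rule rank_mat2_one) (simp_all add: det_2 mat2_eq_iff)
  then have "convex_on UNIV (\<lambda>t. F (mat ?s + t *\<^sub>R mat2 0 1 0 0))"
    using roc unfolding rank_one_convex_def by blast
  \<comment> \<open>\<open>mat ?s\<close> is the midpoint of two shears at which F takes the value
    \<open>F A\<close>.\<close>
  from convex_onD[OF this, of "1/2" "2 * ?v" "- 2 * ?v"] show ?thesis
    using shear[of "2 * ?v"] shear[of "- 2 * ?v"] conformal_norm_nonneg(2)[of A] by simp
qed

text \<open>The weighted arithmetic-geometric mean inequality for \<open>x powr q\<close> and 1 with
  weights 1/q and 1 - 1/q, multiplied by q.\<close>

lemma Bernoulli_inequality_powr:
  assumes "1 \<le> q" "0 \<le> (x::real)"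
  shows "1 + q * (x - 1) \<le> x powr q"
proof (cases "x = 0")
  case False
  have "(x powr q) powr (1 / q) * 1 powr (1 - 1 / q) \<le> (1 / q) * x powr q + (1 - 1 / q) * 1"
    using assms False by (intro Youngs_inequality_0) auto
  then have "x \<le> x powr q / q + (1 - 1 / q)"
    using assms by (simp add: powr_powr)
  then have "q * x \<le> q * (x powr q / q + (1 - 1 / q))"
    using assms by (intro mult_left_mono) auto
  also have "\<dots> = x powr q + (q - 1)"
    using assms by (simp add: distrib_left right_diff_distrib)
  finally show ?thesis by (simp add: algebra_simps)
qed (use assms in simp)

text \<open>With r = det A / t^2, homogeneity turns the bound by the conformal matrix of equal
  determinant into \<open>r powr (p / 2) * F (mat t)\<close>. The power is then replaced by its
  tangent at r = 1, which lies below it because p/2 >= 1.\<close>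

lemma polyconvex_lower_bound:
  fixes F :: "real^2^2 \<Rightarrow> real"
  assumes "isotropic F" "rank_one_convex F" "positively_homogeneous p F" "\<forall>A. 0 \<le> F A"
    and "2 \<le> p" "0 < t"
  shows "F (mat t) * (1 + p / 2 * (det A / t\<^sup>2 - 1)) \<le> F A"
proof (cases "0 < det A")
  case True
  define r where "r = det A / t\<^sup>2"
  have r: "0 < r" using True assms by (simp add: r_def)
  have m: "mat (k * t) = k *\<^sub>R (mat t :: real^2^2)" for k by (simp add: mat2_mat mat2_scaleR)
  have "sqrt r * t = sqrt (det A)"
    using assms by (simp add: r_def real_sqrt_divide)
  then have "mat (sqrt (det A)) = sqrt r *\<^sub>R (mat t :: real^2^2)" by (metis m)
  then have "F (mat (sqrt (det A))) = sqrt r powr p * F (mat t)"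
    using assms(3) r unfolding positively_homogeneous_def by (simp del: real_sqrt_eq_0_iff)
  also have "sqrt r powr p = r powr (p / 2)"
    using r by (simp add: powr_half_sqrt[symmetric] powr_powr)
  finally have "r powr (p / 2) * F (mat t) \<le> F A"
    using rank_one_convex_ge_conformal[OF assms(1,2) True] by simp
  moreover have "(1 + p / 2 * (r - 1)) * F (mat t) \<le> r powr (p / 2) * F (mat t)"
    using assms r by (intro mult_right_mono Bernoulli_inequality_powr) auto
  ultimately show ?thesis by (simp add: r_def mult.commute)
next
  case False
  \<comment> \<open>Without a positive determinant the affine factor is at most 1 - p/2 <= 0, so
    nonnegativity of F suffices.\<close>
  then have "det A / t\<^sup>2 \<le> 0" by (simp add: divide_le_0_iff)
  then have "1 * 1 \<le> p / 2 * (1 - det A / t\<^sup>2)"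
    using assms(5) by (intro mult_mono) auto
  also have "\<dots> = - (p / 2 * (det A / t\<^sup>2 - 1))" by (simp only: mult_minus_right[symmetric] minus_diff_eq)
  finally have "1 + p / 2 * (det A / t\<^sup>2 - 1) \<le> 0" by linarith
  then show ?thesis
    using assms(4) mult_nonneg_nonpos order_trans by blast
qed

text \<open>Denominators are cleared so that instances can be scaled and added.\<close>

lemma convex_on_three_points:
  fixes g :: "real \<Rightarrow> real"
  assumes "convex_on UNIV g" "x \<le> z" "z \<le> y"
  shows "(y - x) * g z \<le> (y - z) * g x + (z - x) * g y"
proof (cases "x = y")
  case False
  then have xy: "x < y" using assms by simp
  let ?t = "(z - x) / (y - x)"
  have "g ((1 - ?t) *\<^sub>R x + ?t *\<^sub>R y) \<le> (1 - ?t) * g x + ?t * g y"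
    using assms xy by (intro convex_onD[OF assms(1)]) (auto simp: field_simps)
  moreover have eq: "(1 - t) *\<^sub>R x + t *\<^sub>R y = x + t * (y - x)" for t
    by (simp add: algebra_simps)
  have "(1 - ?t) *\<^sub>R x + ?t *\<^sub>R y = z"
    unfolding eq using xy by simp
  ultimately have "(y - x) * g z \<le> (y - x) * ((1 - ?t) * g x + ?t * g y)"
    using xy by (intro mult_left_mono) auto
  also have "\<dots> = ((y - x) - (y - x) * ?t) * g x + ((y - x) * ?t) * g y"
    by (simp add: algebra_simps)
  also have "\<dots> = (y - z) * g x + (z - x) * g y"
    using xy by simp
  finally show ?thesis .
qed (use assms in auto)

text \<open>By the inversion symmetry, \<open>p/2 * g 1\<close> lies between the one-sided derivatives of
  \<open>g\<close> at 1.\<close>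

lemma convex_inversion_symmetric_bound:
  fixes g :: "real \<Rightarrow> real"
  assumes g: "convex_on UNIV g" and inv: "\<And>\<tau>. 0 < \<tau> \<Longrightarrow> g \<tau> = \<tau> powr p * g (1 / \<tau>)"
    and "0 \<le> g 1" "1 \<le> p" "s \<le> 1"
  shows "g 1 * (1 + p / 2 * (s - 1)) \<le> g s"
proof (cases "s = 1")
  case False
  \<comment> \<open>Convexity is used on s < \<tau> < 1 and on s < 1 < 1/\<tau>. The inversion
    symmetry expresses g(1/\<tau>) by g(\<tau>), which is then eliminated between the two
    inequalities.\<close>
  have bound: "(1 + \<tau> powr (p - 1)) * (g 1 - g s) \<le> g 1 * p * (1 - s)"
    if \<tau>: "s < \<tau>" "0 < \<tau>" "\<tau> < 1" for \<tau>
  proof -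
    define w where "w = \<tau> powr (p - 1)"
    have w: "w > 0" using \<tau> by (simp add: w_def)
    have w\<tau>: "w * \<tau> = \<tau> powr p" using \<tau> by (simp add: w_def powr_diff)
    have 1: "(1 - s) * g \<tau> \<le> (1 - \<tau>) * g s + (\<tau> - s) * g 1"
      using convex_on_three_points[OF g, of s \<tau> 1] \<tau> by simp
    have "(1 / \<tau> - s) * g 1 \<le> (1 / \<tau> - 1) * g s + (1 - s) * g (1 / \<tau>)"
      using \<tau> by (intro convex_on_three_points[OF g]) auto
    then have "(w * \<tau>) * ((1 / \<tau> - s) * g 1) \<le> (w * \<tau>) * ((1 / \<tau> - 1) * g s + (1 - s) * g (1 / \<tau>))"
      using w \<tau> by (intro mult_left_mono) auto
    also have "(w * \<tau>) * ((1 / \<tau> - 1) * g s + (1 - s) * g (1 / \<tau>))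
        = w * (\<tau> * (1 / \<tau>) - \<tau>) * g s + (1 - s) * (w * \<tau> * g (1 / \<tau>))"
      by (simp only: algebra_simps)
    also have "w * \<tau> * g (1 / \<tau>) = g \<tau>" using inv[of \<tau>] \<tau> w\<tau> by simp
    also have "(w * \<tau>) * ((1 / \<tau> - s) * g 1) = w * (\<tau> * (1 / \<tau>) - \<tau> * s) * g 1"
      by (simp only: algebra_simps)
    also have "\<tau> * (1 / \<tau>) = 1" using \<tau> by simp
    finally have "w * (1 - \<tau> * s) * g 1 \<le> (w + 1) * (1 - \<tau>) * g s + (\<tau> - s) * g 1"
      using 1 by (simp add: algebra_simps)
    then have 2: "(1 - \<tau>) * ((1 + w) * (g 1 - g s)) \<le> (1 - w * \<tau>) * (g 1 * (1 - s))"
      by (simp add: algebra_simps)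
    \<comment> \<open>Bernoulli bounds 1 - \<tau>^p by p (1 - \<tau>), so that the small factor 1 -
      \<tau> cancels from both sides.\<close>
    have "1 + p * (\<tau> - 1) \<le> w * \<tau>"
      using Bernoulli_inequality_powr[of p \<tau>] \<open>1 \<le> p\<close> \<tau> w\<tau> by simp
    then have 3: "1 - w * \<tau> \<le> p * (1 - \<tau>)"
      by (simp add: right_diff_distrib)
    have "(1 - \<tau>) * ((1 + w) * (g 1 - g s)) \<le> (p * (1 - \<tau>)) * (g 1 * (1 - s))"
      using \<open>0 \<le> g 1\<close> \<open>s \<le> 1\<close> by (intro order_trans[OF 2] mult_right_mono 3) auto
    also have "\<dots> = (1 - \<tau>) * (g 1 * p * (1 - s))"
      by (simp only: mult_ac)
    finally have "(1 + w) * (g 1 - g s) \<le> g 1 * p * (1 - s)"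
      using \<tau> by (simp only: mult_le_cancel_left_pos diff_gt_0_iff_gt)
    then show ?thesis by (simp only: w_def)
  qed
  \<comment> \<open>As \<tau> tends to 1 from below the factor on the left tends to 2, which turns p
    into p/2.\<close>
  have "((\<lambda>\<tau>. (1 + \<tau> powr (p - 1)) * (g 1 - g s)) \<longlongrightarrow> (1 + 1 powr (p - 1)) * (g 1 - g s)) (at_left 1)"
    by (intro tendsto_intros) auto
  moreover have "\<forall>\<^sub>F \<tau> in at_left 1. (1 + \<tau> powr (p - 1)) * (g 1 - g s) \<le> g 1 * p * (1 - s)"
    unfolding eventually_at_left_field
    by (rule exI[of _ "max s 0"]) (use bound False \<open>s \<le> 1\<close> in auto)
  ultimately have "(1 + 1 powr (p - 1)) * (g 1 - g s) \<le> g 1 * p * (1 - s)"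
    by (rule tendsto_upperbound) simp
  then show ?thesis by (simp add: field_simps)
qed simp

text \<open>Dividing by the larger singular value \<open>x\<close> leaves a function
  \<open>g\<close> of the signed ratio y/x <= 1. It is convex because diag(1, t) moves in a rank-one
  direction, and it has the inversion symmetry because exchanging the diagonal entries changes
  neither of the two norms. Multiplying its supporting line at 1 by x^p produces exactly p/2 times
  the Burkholder integrand.\<close>

lemma burkholder_lower_bound:
  fixes F :: "real^2^2 \<Rightarrow> real"
  assumes iso: "isotropic F" and roc: "rank_one_convex F" and hom: "positively_homogeneous p F"
    and nonneg: "\<forall>A. 0 \<le> F A" and p: "1 \<le> p" "p \<le> 2"
  shows "F (mat 1) * (p / 2) * burkholder p A \<le> F A"
proof (cases "A = 0")
  case True
  then show ?thesis using nonneg by (simp add: burkholder_def)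
next
  case False
  let ?u = "conformal_norm A" and ?v = "anticonformal_norm A"
  define x y where "x = ?u + ?v" and "y = ?u - ?v"
  have x: "0 < x"
  proof (rule ccontr)
    assume "\<not> 0 < x"
    then have "onorm ((*v) A) = 0"
      using conformal_norm_nonneg[of A] opnorm_conformal[of A] unfolding x_def by simp
    then show False using False
      by (metis matrix_eq matrix_vector_mul_bounded_linear onorm_eq_0 matrix_vector_mult_0)
  qed
  have "y \<le> x" using conformal_norm_nonneg[of A] by (simp add: x_def y_def)
  then have s: "y / x \<le> 1" using x by simp
  have A: "F A = F (mat2 x 0 0 y)" unfolding x_def y_def by (rule isotropic_diagonal[OF iso])
  define g where "g t = F (mat2 1 0 0 t)" for t
  have gx: "F (mat2 x 0 0 y) = x powr p * g (y / x)" if "0 < x" for x y :: real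
  proof -
    have "mat2 x 0 0 y = x *\<^sub>R mat2 1 0 0 (y / x)" using that by (simp add: mat2_scaleR)
    then show ?thesis using hom that unfolding positively_homogeneous_def g_def by simp
  qed
  have "rank (mat2 0 0 0 1) = 1" by (rule rank_mat2_one) (simp_all add: det_2 mat2_eq_iff)
  then have "convex_on UNIV (\<lambda>t. F (mat2 1 0 0 0 + t *\<^sub>R mat2 0 0 0 1))"
    using roc unfolding rank_one_convex_def by blast
  then have g: "convex_on UNIV g" unfolding mat2_scaleR mat2_add g_def by simp
  have inv: "g \<tau> = \<tau> powr p * g (1 / \<tau>)" if "0 < \<tau>" for \<tau>
  proof -
    have "g \<tau> = F (mat2 \<tau> 0 0 1)" unfolding g_def
      by (rule isotropic_cong[OF iso])
        (simp_all add: conformal_norm_def anticonformal_norm_def add.commute power2_commute)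
    then show ?thesis using gx[OF that, of 1] by simp
  qed
  have "g 1 * (1 + p / 2 * (y / x - 1)) \<le> g (y / x)"
    using convex_inversion_symmetric_bound[OF g inv] s p nonneg by (simp add: g_def)
  then have "x powr p * (g 1 * (1 + p / 2 * (y / x - 1))) \<le> F A"
    unfolding A gx[OF x] using x by (intro mult_left_mono) auto
  moreover have "x powr p * (g 1 * (1 + p / 2 * (y / x - 1))) = g 1 * (p / 2) * burkholder p A"
  proof -
    \<comment> \<open>Here \<open>x\<close> is the operator norm and \<open>x * y\<close> the
      determinant; p <= 2 resolves the absolute value to 2/p - 1.\<close>
    have b: "burkholder p A = ((2 / p - 1) * x\<^sup>2 + x * y) * x powr (p - 2)"
      using False p unfolding burkholder_def opnorm_conformal det_conformal x_def y_def
      by (simp add: abs_if power2_eq_square algebra_simps)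
    have xp: "x powr p = x\<^sup>2 * x powr (p - 2)"
      using x by (simp add: powr_diff powr_numeral)
    have e: "x\<^sup>2 * (1 + p / 2 * (y / x - 1)) = p / 2 * ((2 / p - 1) * x\<^sup>2 + x * y)"
      using x p by (simp add: field_simps power2_eq_square)
    have "x powr p * (g 1 * (1 + p / 2 * (y / x - 1)))
        = (x\<^sup>2 * (1 + p / 2 * (y / x - 1))) * (g 1 * x powr (p - 2))"
      unfolding xp by (simp only: mult_ac)
    also have "\<dots> = g 1 * (p / 2) * burkholder p A"
      unfolding e b by (simp only: mult_ac)
    finally show ?thesis .
  qed
  ultimately show ?thesis by (simp only: g_def mat2_mat)
qed

text \<open>At \<open>mat t\<close> the determinant equals the squared norm, so the bracket is (2/p)
  t^2. The factor p/2 normalises this and gives equality in the lower bound at positive multiples of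
  the identity.\<close>

lemma burkholder_conformal:
  assumes "1 \<le> p" "p \<le> 2" "0 < t"
  shows "p / 2 * burkholder p (mat t) = t powr p"
proof -
  have "mat t \<noteq> (0 :: real^2^2)" using assms by (simp add: mat2_eq_iff mat_def)
  moreover have "opnorm (mat t :: real^2^2) = t"
    using assms
    by (simp add: opnorm_conformal conformal_norm_def anticonformal_norm_def mat2_mat real_sqrt_mult)
  moreover have "det (mat t :: real^2^2) = t\<^sup>2" by (simp add: mat2_mat det_2 power2_eq_square)
  moreover have "t powr p = t\<^sup>2 * t powr (p - 2)"
    using assms by (simp add: powr_diff powr_numeral)
  ultimately show ?thesis
    using assms unfolding burkholder_def by (simp add: abs_if field_simps)
qed

section \<open>Weak gradients and null Lagrangians\<close>

lemma test_functions_jacobian_nth: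
  fixes \<psi> :: "real^'n \<Rightarrow> real^'m"
  assumes "\<psi> \<in> test_functions \<Omega>"
  shows "jacobian \<psi> (at x) $ i $ j = frechet_derivative (\<lambda>x. \<psi> x $ i) (at x) (axis j 1)"
  using frechet_derivative_bounded_linear_compose[OF bounded_linear_vec_nth
      test_functions_differentiable[OF assms], of i x]
  by (simp add: jacobian_def matrix_def)

lemma test_functions_nth:
  fixes \<psi> :: "real^'n \<Rightarrow> real^'m"
  shows "\<psi> \<in> test_functions \<Omega> \<Longrightarrow> (\<lambda>x. \<psi> x $ i) \<in> test_functions \<Omega>"
  by (rule test_functions_bounded_linear_compose[OF bounded_linear_vec_nth])

lemma matrix_entry_expansion:
  fixes M :: "real^'n^'m"
  shows "M = (\<Sum>i\<in>UNIV. \<Sum>j\<in>UNIV. M $ i $ j *\<^sub>R axis i (axis j 1))"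
proof -
  have "(\<Sum>j\<in>UNIV. M $ i $ j *\<^sub>R axis i (axis j 1)) = axis i (M $ i)" for i
    by (auto simp: vec_eq_iff axis_def if_distrib [where f="\<lambda>x. _ * x"] cong: if_cong)
  moreover have "(\<Sum>i\<in>UNIV. axis i (M $ i)) = M"
    by (simp add: vec_eq_iff axis_def if_distrib [where f="\<lambda>x. x $ _"] cong: if_cong)
  ultimately show ?thesis by simp
qed

lemma test_functions_jacobian_integrable:
  fixes \<psi> :: "real^'n \<Rightarrow> real^'m"
  assumes "\<psi> \<in> test_functions \<Omega>" "open \<Omega>"
  shows "integrable (lebesgue_on \<Omega>) (\<lambda>x. jacobian \<psi> (at x))"
proof -
  have "integrable (lebesgue_on \<Omega>) (\<lambda>x. jacobian \<psi> (at x) $ i $ j)" for i j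
    unfolding test_functions_jacobian_nth[OF assms(1)]
    by (intro test_functions_lebesgue_on(1)[OF _ assms(2)] test_functions_frechet_derivative
        test_functions_nth[OF assms(1)]) (simp add: axis_in_Basis_iff)
  then have "integrable (lebesgue_on \<Omega>)
      (\<lambda>x. \<Sum>i\<in>UNIV. \<Sum>j\<in>UNIV. jacobian \<psi> (at x) $ i $ j *\<^sub>R axis i (axis j 1))"
    by (intro Bochner_Integration.integrable_sum integrable_scaleR_left)
  moreover have "(\<lambda>x. jacobian \<psi> (at x))
      = (\<lambda>x. \<Sum>i\<in>UNIV. \<Sum>j\<in>UNIV. jacobian \<psi> (at x) $ i $ j *\<^sub>R axis i (axis j 1))"
    by (intro ext matrix_entry_expansion)
  ultimately show ?thesis by simp
qed

lemma bounded_linear_matrix_nth: "bounded_linear (\<lambda>M :: real^'n^'m. M $ i $ j)"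
  using bounded_linear_compose[OF bounded_linear_vec_nth bounded_linear_vec_nth] .

lemma integrable_bounded_mult:
  fixes f g :: "'a \<Rightarrow> real"
  assumes "g \<in> borel_measurable M" "AE x in M. \<bar>g x\<bar> \<le> C" "integrable M f"
  shows "integrable M (\<lambda>x. g x * f x)"
proof (rule Bochner_Integration.integrable_bound)
  show "integrable M (\<lambda>x. C * f x)" using assms(3) by simp
  show "(\<lambda>x. g x * f x) \<in> borel_measurable M" using assms by simp
  show "AE x in M. norm (g x * f x) \<le> norm (C * f x)"
    using assms(2) by eventually_elim (auto simp: abs_mult intro!: mult_right_mono)
qed

text \<open>A product passes to the limit when one factor stays fixed and essentially bounded while
  the other converges in the mean. In the determinant the fixed factor is an entry of
  \<open>D\<close>, and \<open>L\<close> selects the entry that is approximated.\<close>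

lemma tendsto_integral_bounded_mult:
  fixes J :: "nat \<Rightarrow> 'a \<Rightarrow> 'b::euclidean_space" and D :: "'a \<Rightarrow> 'b"
    and g :: "'a \<Rightarrow> real" and L :: "'b \<Rightarrow> real"
  assumes J: "\<And>k. integrable M (J k)" and D: "integrable M D"
    and lim: "(\<lambda>k. \<integral>x. norm (J k x - D x) \<partial>M) \<longlonglongrightarrow> 0"
    and g: "g \<in> borel_measurable M" "AE x in M. \<bar>g x\<bar> \<le> C" and L: "bounded_linear L"
  shows "(\<lambda>k. \<integral>x. g x * L (J k x) \<partial>M) \<longlonglongrightarrow> (\<integral>x. g x * L (D x) \<partial>M)"
proof -
  obtain K where K: "0 < K" "\<And>x. norm (L x) \<le> norm x * K"
    using bounded_linear.pos_bounded[OF L] by blast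
  have i: "integrable M (\<lambda>x. g x * L (f x))" if "integrable M f" for f
    by (intro integrable_bounded_mult[OF g] integrable_bounded_linear[OF L that])
  have C: "AE x in M. norm (g x * L (J k x - D x)) \<le> (\<bar>C\<bar> * K) * norm (J k x - D x)" for k
    using g(2)
  proof eventually_elim
    case (elim x)
    have "\<bar>g x\<bar> * \<bar>L (J k x - D x)\<bar> \<le> \<bar>C\<bar> * (norm (J k x - D x) * K)"
      using elim K by (intro mult_mono) auto
    then show ?case by (simp add: abs_mult mult_ac)
  qed
  have "norm ((\<integral>x. g x * L (J k x) \<partial>M) - (\<integral>x. g x * L (D x) \<partial>M))
      \<le> (\<bar>C\<bar> * K) * (\<integral>x. norm (J k x - D x) \<partial>M)" for k
  proof -
    have "(\<integral>x. g x * L (J k x) \<partial>M) - (\<integral>x. g x * L (D x) \<partial>M) = (\<integral>x. g x * L (J k x - D x) \<partial>M)"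
      using i[OF J[of k]] i[OF D] bounded_linear.linear[OF L]
      by (simp add: linear_diff right_diff_distrib)
    also have "norm \<dots> \<le> (\<integral>x. norm (g x * L (J k x - D x)) \<partial>M)"
      by (rule integral_norm_bound)
    also have "\<dots> \<le> (\<integral>x. (\<bar>C\<bar> * K) * norm (J k x - D x) \<partial>M)"
      by (rule integral_mono_AE[OF _ _ C]) (simp_all add: i J D)
    finally show ?thesis by simp
  qed
  then have "(\<lambda>k. (\<integral>x. g x * L (J k x) \<partial>M) - (\<integral>x. g x * L (D x) \<partial>M)) \<longlonglongrightarrow> 0"
    by (intro Lim_null_comparison[OF always_eventually[OF allI]
          tendsto_mult_right_zero[OF lim, of "\<bar>C\<bar> * K"]])
  then show ?thesis by (rule LIM_zero_cancel)
qed

lemma Linfty_bounded_linear: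
  fixes f :: "'a::euclidean_space \<Rightarrow> 'b::euclidean_space" and L :: "'b \<Rightarrow> 'c::euclidean_space"
  assumes "bounded_linear L" "Linfty \<Omega> f"
  shows "Linfty \<Omega> (\<lambda>x. L (f x))"
proof -
  obtain C where C: "AE x in lebesgue_on \<Omega>. norm (f x) \<le> C" and
    f: "f \<in> borel_measurable (lebesgue_on \<Omega>)"
    using assms(2) unfolding Linfty_def by blast
  obtain K where K: "0 < K" "\<And>x. norm (L x) \<le> norm x * K"
    using bounded_linear.pos_bounded[OF assms(1)] by blast
  have "AE x in lebesgue_on \<Omega>. norm (L (f x)) \<le> C * K"
    using C
  proof eventually_elim
    case (elim x)
    then have "norm (f x) * K \<le> C * K" using K(1) by simp
    then show ?case using K(2) order_trans by blast
  qed
  moreover have "(\<lambda>x. L (f x)) \<in> borel_measurable (lebesgue_on \<Omega>)"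
    using measurable_compose[OF f borel_measurable_continuous_onI[OF linear_continuous_on[OF assms(1)]]] .
  ultimately show ?thesis unfolding Linfty_def by blast
qed

lemma tendsto_zero_summands:
  fixes a b :: "nat \<Rightarrow> real"
  assumes "(\<lambda>k. a k + b k) \<longlonglongrightarrow> 0" "\<And>k. 0 \<le> a k" "\<And>k. 0 \<le> b k"
  shows "a \<longlonglongrightarrow> 0" "b \<longlonglongrightarrow> 0"
proof -
  show "a \<longlonglongrightarrow> 0"
    by (rule tendsto_sandwich[OF _ _ tendsto_const assms(1)])
      (use assms(2,3) in \<open>simp_all add: always_eventually\<close>)
  show "b \<longlonglongrightarrow> 0"
    by (rule tendsto_sandwich[OF _ _ tendsto_const assms(1)])
      (use assms(2,3) in \<open>simp_all add: always_eventually\<close>)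
qed

lemma W01_1_approximation:
  assumes "W01_1 \<Omega> \<phi> D"
  shows "\<exists>\<psi>. (\<forall>k. \<psi> k \<in> test_functions \<Omega>) \<and>
    (\<lambda>k. \<integral>x. norm (\<psi> k x - \<phi> x) \<partial>lebesgue_on \<Omega>) \<longlonglongrightarrow> 0 \<and>
    (\<lambda>k. \<integral>x. norm (jacobian (\<psi> k) (at x) - D x) \<partial>lebesgue_on \<Omega>) \<longlonglongrightarrow> 0"
proof -
  obtain \<psi> where \<psi>: "\<forall>k. \<psi> k \<in> test_functions \<Omega>" and
    lim: "(\<lambda>k. (\<integral>x. norm (\<psi> k x - \<phi> x) \<partial>lebesgue_on \<Omega>)
       + (\<integral>x. norm (jacobian (\<psi> k) (at x) - D x) \<partial>lebesgue_on \<Omega>)) \<longlonglongrightarrow> 0"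
    using assms unfolding W01_1_def by blast
  show ?thesis
    by (intro exI[of _ \<psi>] conjI \<psi> tendsto_zero_summands[OF lim]) simp_all
qed

lemma test_functions_integral_jacobian:
  fixes \<psi> :: "real^'n \<Rightarrow> real^'m"
  assumes "\<psi> \<in> test_functions \<Omega>" "open \<Omega>"
  shows "(\<integral>x. jacobian \<psi> (at x) $ i $ j \<partial>lebesgue_on \<Omega>) = 0"
proof -
  have b: "axis j (1::real) \<in> Basis" by (simp add: axis_in_Basis_iff)
  note \<psi>i = test_functions_nth[OF assms(1), of i]
  show ?thesis
    unfolding test_functions_jacobian_nth[OF assms(1)]
      test_functions_lebesgue_on(2)[OF test_functions_frechet_derivative[OF \<psi>i b] assms(2)]
    by (rule test_functions_integral_derivative_lborel[OF \<psi>i b])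
qed

text \<open>Holds for Jacobians of test functions and passes to the limit in the mean; the bounded
  factor is the constant 1.\<close>

lemma W01_1_integral_gradient:
  assumes "W01_1 \<Omega> \<phi> D" "open \<Omega>"
  shows "(\<integral>x. D x $ i $ j \<partial>lebesgue_on \<Omega>) = 0"
proof -
  obtain \<psi> where "\<forall>k. \<psi> k \<in> test_functions \<Omega>"
    and lim: "(\<lambda>k. \<integral>x. norm (jacobian (\<psi> k) (at x) - D x) \<partial>lebesgue_on \<Omega>) \<longlonglongrightarrow> 0"
    using W01_1_approximation[OF assms(1)] by blast
  then have \<psi>: "\<psi> k \<in> test_functions \<Omega>" for k by blast
  have D: "integrable (lebesgue_on \<Omega>) D" using assms(1) unfolding W01_1_def by blast
  have J: "integrable (lebesgue_on \<Omega>) (\<lambda>x. jacobian (\<psi> k) (at x))" for k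
    by (rule test_functions_jacobian_integrable[OF \<psi> assms(2)])
  have "(\<lambda>k. \<integral>x. 1 * (jacobian (\<psi> k) (at x) $ i $ j) \<partial>lebesgue_on \<Omega>)
      \<longlonglongrightarrow> (\<integral>x. 1 * D x $ i $ j \<partial>lebesgue_on \<Omega>)"
    by (rule tendsto_integral_bounded_mult[where C=1, OF J D lim _ _ bounded_linear_matrix_nth])
      simp_all
  then show ?thesis
    by (simp add: test_functions_integral_jacobian[OF \<psi> assms(2)] LIMSEQ_const_iff)
qed

lemma Linfty_matrix_nth:
  fixes D :: "real^'n \<Rightarrow> real^'n^'m"
  assumes "Linfty \<Omega> D"
  shows "\<exists>C. AE x in lebesgue_on \<Omega>. \<bar>D x $ i $ j\<bar> \<le> C"
    and "(\<lambda>x. D x $ i $ j) \<in> borel_measurable (lebesgue_on \<Omega>)"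
proof -
  have "Linfty \<Omega> (\<lambda>x. D x $ i $ j)"
    by (rule Linfty_bounded_linear[OF bounded_linear_matrix_nth assms])
  note L = this[unfolded Linfty_def real_norm_def]
  show "\<exists>C. AE x in lebesgue_on \<Omega>. \<bar>D x $ i $ j\<bar> \<le> C" by (rule conjunct2[OF L])
  show "(\<lambda>x. D x $ i $ j) \<in> borel_measurable (lebesgue_on \<Omega>)" by (rule conjunct1[OF L])
qed

text \<open>One factor of each product is approximated by derivatives of test functions. The weak
  gradient identity moves the other derivative onto the test function, where the two second
  derivatives cancel.\<close>

lemma W01_inf_integral_det:
  fixes \<phi> :: "real^2 \<Rightarrow> real^2"
  assumes W: "W01_inf \<Omega> \<phi> D" and "open \<Omega>"
  shows "(\<integral>x. det (D x) \<partial>lebesgue_on \<Omega>) = 0"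
proof -
  let ?M = "lebesgue_on \<Omega>"
  have W11: "W01_1 \<Omega> \<phi> D" and bd: "Linfty \<Omega> D" and wg: "weak_gradient \<Omega> \<phi> D"
    and D: "integrable ?M D"
    using W unfolding W01_inf_def W1_inf_def W01_1_def by auto
  obtain \<psi> where "\<forall>k. \<psi> k \<in> test_functions \<Omega>"
    and lim: "(\<lambda>k. \<integral>x. norm (jacobian (\<psi> k) (at x) - D x) \<partial>?M) \<longlonglongrightarrow> 0"
    using W01_1_approximation[OF W11] by blast
  then have \<psi>: "\<psi> k \<in> test_functions \<Omega>" for k by blast
  have J: "integrable ?M (\<lambda>x. jacobian (\<psi> k) (at x))" for k
    by (rule test_functions_jacobian_integrable[OF \<psi> assms(2)])
  have conv: "(\<lambda>k. \<integral>x. D x $ i $ j * jacobian (\<psi> k) (at x) $ i' $ j' \<partial>?M)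
      \<longlonglongrightarrow> (\<integral>x. D x $ i $ j * D x $ i' $ j' \<partial>?M)" for i j i' j'
  proof -
    obtain C where "AE x in ?M. \<bar>D x $ i $ j\<bar> \<le> C" using Linfty_matrix_nth(1)[OF bd] by blast
    then show ?thesis
      by (intro tendsto_integral_bounded_mult[where C=C] J D lim Linfty_matrix_nth(2)[OF bd]
          bounded_linear_matrix_nth)
  qed
  have int: "integrable ?M (\<lambda>x. D x $ i $ j * D x $ i' $ j')" for i j i' j'
  proof -
    obtain C where "AE x in ?M. \<bar>D x $ i $ j\<bar> \<le> C" using Linfty_matrix_nth(1)[OF bd] by blast
    then show ?thesis
      by (intro integrable_bounded_mult[where C=C] Linfty_matrix_nth(2)[OF bd]
          integrable_bounded_linear[OF bounded_linear_matrix_nth D])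
  qed
  have eq: "(\<integral>x. D x $ 1 $ 1 * jacobian (\<psi> k) (at x) $ 2 $ 2 \<partial>?M)
      = (\<integral>x. D x $ 1 $ 2 * jacobian (\<psi> k) (at x) $ 2 $ 1 \<partial>?M)" for k
  proof -
    define f where "f x = \<psi> k x $ 2" for x
    have f: "f \<in> test_functions \<Omega>" unfolding f_def by (rule test_functions_nth[OF \<psi>])
    let ?d = "\<lambda>j x. frechet_derivative f (at x) (axis j 1)"
    have d: "?d j \<in> test_functions \<Omega>" for j
      by (intro test_functions_frechet_derivative f) (simp add: axis_in_Basis_iff)
    have dd: "(\<lambda>x. frechet_derivative (?d j) (at x) (axis i 1)) \<in> test_functions \<Omega>" for i j
      by (intro test_functions_frechet_derivative d) (simp add: axis_in_Basis_iff)
    have "frechet_derivative (?d 2) (at x) (axis 1 1) = frechet_derivative (?d 1) (at x) (axis 2 1)" for x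
      by (intro symmetric_mixed_derivatives test_functions_differentiable[OF f]
          test_functions_differentiable[OF d] test_functions_continuous[OF dd])
    then have "(\<integral>x. \<phi> x $ 1 * frechet_derivative (?d 2) (at x) (axis 1 1) \<partial>?M)
        = (\<integral>x. \<phi> x $ 1 * frechet_derivative (?d 1) (at x) (axis 2 1) \<partial>?M)" by simp
    moreover have "(\<integral>x. \<phi> x $ 1 * frechet_derivative (?d j) (at x) (axis j' 1) \<partial>?M)
        = - (\<integral>x. D x $ 1 $ j' * ?d j x \<partial>?M)" for j j'
      using wg d unfolding weak_gradient_def by blast
    ultimately show ?thesis
      unfolding test_functions_jacobian_nth[OF \<psi>] f_def[abs_def] by simp
  qed
  have "(\<integral>x. D x $ 1 $ 1 * D x $ 2 $ 2 \<partial>?M) = (\<integral>x. D x $ 1 $ 2 * D x $ 2 $ 1 \<partial>?M)"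
    using conv[of 1 1 2 2] conv[of 1 2 2 1] unfolding eq by (rule LIMSEQ_unique)
  then show ?thesis using int by (simp add: det_2)
qed

text \<open>In two dimensions det(A + X) is det A plus terms linear in X plus det X, and the last
  two contributions integrate to zero.\<close>

lemma W01_inf_integral_det_affine:
  fixes \<phi> :: "real^2 \<Rightarrow> real^2"
  assumes W: "W01_inf \<Omega> \<phi> D" and \<Omega>: "open \<Omega>" "bounded \<Omega>"
  shows "(\<integral>x. det (A + D x) \<partial>lebesgue_on \<Omega>) = measure lebesgue \<Omega> * det A"
    and "integrable (lebesgue_on \<Omega>) (\<lambda>x. det (A + D x))"
proof -
  let ?M = "lebesgue_on \<Omega>"
  interpret finite_measure ?M
    using \<Omega> by (intro finite_measure_lebesgue_on lmeasurable_open)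
  have W11: "W01_1 \<Omega> \<phi> D" and bd: "Linfty \<Omega> D" and D: "integrable ?M D"
    using W unfolding W01_inf_def W1_inf_def W01_1_def by auto
  have int1: "integrable ?M (\<lambda>x. D x $ i $ j)" for i j
    by (intro integrable_bounded_linear[OF bounded_linear_matrix_nth D])
  have "integrable ?M (\<lambda>x. D x $ i $ j * D x $ i' $ j')" for i j i' j'
  proof -
    obtain C where "AE x in ?M. \<bar>D x $ i $ j\<bar> \<le> C" using Linfty_matrix_nth(1)[OF bd] by blast
    then show ?thesis
      by (intro integrable_bounded_mult[where C=C] Linfty_matrix_nth(2)[OF bd] int1)
  qed
  then have int2: "integrable ?M (\<lambda>x. det (D x))" by (simp add: det_2)
  have e: "det (A + D x) = det A + A $ 1 $ 1 * D x $ 2 $ 2 + A $ 2 $ 2 * D x $ 1 $ 1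
      - A $ 1 $ 2 * D x $ 2 $ 1 - A $ 2 $ 1 * D x $ 1 $ 2 + det (D x)" for x
    by (simp add: det_2 algebra_simps)
  show "integrable ?M (\<lambda>x. det (A + D x))" unfolding e using int1 int2 by simp
  have "measure ?M \<Omega> = measure lebesgue \<Omega>" using \<Omega> by (simp add: measure_restrict_space)
  then show "(\<integral>x. det (A + D x) \<partial>?M) = measure lebesgue \<Omega> * det A"
    unfolding e using int1 int2 W01_inf_integral_det[OF W \<Omega>(1)] W01_1_integral_gradient[OF W11 \<Omega>(1)]
    by simp
qed

section \<open>Quasiconvexity by comparison from below\<close>

text \<open>The quasiconvexity inequality is an equality here, so \<open>b\<close> may have either
  sign.\<close>

lemma quasiconvex_at_det:
  assumes "bounded_domain \<Omega>"
  shows "quasiconvex_at \<Omega> (\<lambda>X :: real^2^2. a + b * det X) A"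
proof -
  have \<Omega>: "open \<Omega>" "bounded \<Omega>" "\<Omega> \<noteq> {}" using assms unfolding bounded_domain_def by auto
  interpret finite_measure "lebesgue_on \<Omega>"
    using \<Omega> by (intro finite_measure_lebesgue_on lmeasurable_open)
  have pos: "measure lebesgue \<Omega> \<noteq> 0"
    using open_not_negligible[OF \<Omega>(1,3)] lmeasurable_open[OF \<Omega>(2,1)]
    by (simp add: negligible_iff_measure)
  have m: "measure (lebesgue_on \<Omega>) \<Omega> = measure lebesgue \<Omega>"
    using \<Omega> by (simp add: measure_restrict_space)
  show ?thesis
    unfolding quasiconvex_at_def
  proof (intro allI impI)
    fix \<phi> D assume "W01_inf \<Omega> \<phi> (D :: real^2 \<Rightarrow> real^2^2)"
    note det = W01_inf_integral_det_affine[OF this \<Omega>(1,2), of A]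
    have "(\<integral>x. a + b * det (A + D x) \<partial>lebesgue_on \<Omega>) = measure lebesgue \<Omega> * (a + b * det A)"
      using det(2) by (simp add: det(1) m algebra_simps)
    then show "a + b * det A \<le>
        1 / measure lebesgue \<Omega> * (\<integral>x. a + b * det (A + D x) \<partial>lebesgue_on \<Omega>)"
      using pos by simp
  qed
qed

lemma integrand_bounded_on_compact:
  assumes "integrand F" "compact K"
  shows "bounded (F ` K)"
proof -
  obtain e where e: "\<And>A. 0 < e A" "\<And>A. bounded (F ` ball A (e A))"
    using assms(1) unfolding integrand_def by metis
  have "K \<subseteq> (\<Union>A\<in>K. ball A (e A))" using e(1) by auto
  then obtain S where S: "S \<subseteq> K" "finite S" "K \<subseteq> (\<Union>A\<in>S. ball A (e A))"
    by (rule compactE_image[OF assms(2) open_ball])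
  have "bounded (\<Union>A\<in>S. F ` ball A (e A))" using S e(2) by (intro bounded_UN) auto
  then show ?thesis by (rule bounded_subset) (use S(3) in blast)
qed

text \<open>Almost all values of A + D lie in one compact ball, on which F is bounded, and the
  domain has finite measure. Integrability matters because a nonintegrable function has integral 0
  by convention, which would break monotonicity.\<close>

lemma integrand_integrable:
  fixes D :: "real^'n \<Rightarrow> real^'n^'n"
  assumes F: "integrand F" and D: "Linfty \<Omega> D" and \<Omega>: "open \<Omega>" "bounded \<Omega>"
  shows "integrable (lebesgue_on \<Omega>) (\<lambda>x. F (A + D x))"
proof -
  interpret finite_measure "lebesgue_on \<Omega>"
    using \<Omega> by (intro finite_measure_lebesgue_on lmeasurable_open)
  have m: "D \<in> borel_measurable (lebesgue_on \<Omega>)" "F \<in> borel_measurable borel"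
    using D F unfolding Linfty_def integrand_def by auto
  obtain C where C: "AE x in lebesgue_on \<Omega>. norm (D x) \<le> C" using D unfolding Linfty_def by blast
  obtain B where B: "\<forall>y\<in>F ` cball A C. norm y \<le> B"
    using integrand_bounded_on_compact[OF F compact_cball[of A C]] unfolding bounded_iff ..
  have "norm (F (A + X)) \<le> B" if "norm X \<le> C" for X
    by (rule bspec[OF B imageI]) (use that in \<open>simp add: dist_norm\<close>)
  then have "AE x in lebesgue_on \<Omega>. norm (F (A + D x)) \<le> B"
    using C by (auto elim: AE_mp)
  moreover have "(\<lambda>x. F (A + D x)) \<in> borel_measurable (lebesgue_on \<Omega>)"
    by (rule measurable_compose[OF borel_measurable_add[OF borel_measurable_const m(1)] m(2)])
  ultimately show ?thesis by (rule integrable_const_bound)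
qed

text \<open>The comparison principle: F(A) = k G(A) is at most k times the mean of G, hence at most
  the mean of F. The factor \<open>k\<close> may be zero, as happens when F vanishes at the
  identity.\<close>

lemma quasiconvex_at_lower_bound:
  fixes F G :: "real^'n^'n \<Rightarrow> real"
  assumes "bounded_domain \<Omega>" "integrand F" "integrand G" "quasiconvex_at \<Omega> G A"
    and "0 \<le> k" "\<And>X. k * G X \<le> F X" "F A = k * G A"
  shows "quasiconvex_at \<Omega> F A"
  unfolding quasiconvex_at_def
proof (intro allI impI)
  fix \<phi> :: "real^'n \<Rightarrow> real^'n" and D assume W: "W01_inf \<Omega> \<phi> D"
  have \<Omega>: "open \<Omega>" "bounded \<Omega>" using assms(1) unfolding bounded_domain_def by auto
  have D: "Linfty \<Omega> D" using W unfolding W01_inf_def W1_inf_def by blast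
  have "G A \<le> 1 / measure lebesgue \<Omega> * (\<integral>x. G (A + D x) \<partial>lebesgue_on \<Omega>)"
    using assms(4) W unfolding quasiconvex_at_def by blast
  then have "F A \<le> k * (1 / measure lebesgue \<Omega> * (\<integral>x. G (A + D x) \<partial>lebesgue_on \<Omega>))"
    unfolding assms(7) using assms(5) by (rule mult_left_mono)
  also have "\<dots> = 1 / measure lebesgue \<Omega> * (\<integral>x. k * G (A + D x) \<partial>lebesgue_on \<Omega>)" by simp
  also have "\<dots> \<le> 1 / measure lebesgue \<Omega> * (\<integral>x. F (A + D x) \<partial>lebesgue_on \<Omega>)"
    using integrand_integrable[OF assms(2) D \<Omega>] integrand_integrable[OF assms(3) D \<Omega>] assms(6)
    by (intro mult_left_mono integral_mono) auto
  finally show "F A \<le> 1 / measure lebesgue \<Omega> * (\<integral>x. F (A + D x) \<partial>lebesgue_on \<Omega>)" .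
qed

section \<open>The Burkholder function as an integrand\<close>

lemma integrand_continuous:
  fixes F :: "real^'n^'n \<Rightarrow> real"
  assumes "continuous_on UNIV F"
  shows "integrand F"
proof -
  have "bounded (F ` ball A 1)" for A
    by (rule bounded_subset[OF compact_imp_bounded[OF compact_continuous_image[of "cball A 1" F]]])
      (use assms continuous_on_subset in auto)
  then show ?thesis
    using assms zero_less_one unfolding integrand_def by (metis borel_measurable_continuous_onI)
qed

lemma continuous_on_conformal_norm:
  "continuous_on UNIV conformal_norm" "continuous_on UNIV anticonformal_norm"
  unfolding conformal_norm_def anticonformal_norm_def by (intro continuous_intros; simp)+

lemma continuous_on_det2: "continuous_on UNIV (det :: real^2^2 \<Rightarrow> real)"
  unfolding det_2 by (intro continuous_intros)

text \<open>Both |det A| and |1 - 2/q| |A|^2 are at most |A|^2. The resulting positive power absorbs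
  the factor |A|^(q-2), singular at 0 for q < 2, and yields local boundedness there.\<close>

lemma abs_burkholder_le:
  assumes "1 \<le> q"
  shows "\<bar>burkholder q A\<bar> \<le> 2 * opnorm A powr q"
proof (cases "A = 0")
  case False
  have n: "0 \<le> opnorm A" using onorm_pos_le[of "(*v) A"] by simp
  have "\<bar>det A\<bar> \<le> (opnorm A)\<^sup>2"
    unfolding det_conformal opnorm_conformal using conformal_norm_nonneg[of A]
    by (auto simp: abs_if power2_eq_square algebra_simps)
  moreover have "\<bar>1 - 2 / q\<bar> * (opnorm A)\<^sup>2 \<le> 1 * (opnorm A)\<^sup>2"
    using assms by (intro mult_right_mono) (auto simp: abs_if field_simps)
  ultimately have "\<bar>\<bar>1 - 2 / q\<bar> * (opnorm A)\<^sup>2 + det A\<bar> \<le> 2 * (opnorm A)\<^sup>2"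
    using abs_triangle_ineq[of "\<bar>1 - 2 / q\<bar> * (opnorm A)\<^sup>2" "det A"] by (simp add: abs_mult)
  then have "\<bar>\<bar>1 - 2 / q\<bar> * (opnorm A)\<^sup>2 + det A\<bar> * opnorm A powr (q - 2)
      \<le> (2 * (opnorm A)\<^sup>2) * opnorm A powr (q - 2)"
    by (intro mult_right_mono) auto
  also have "\<dots> = 2 * opnorm A powr q"
    using n by (cases "opnorm A = 0") (simp_all add: powr_diff powr_numeral)
  finally show ?thesis using False by (simp add: burkholder_def abs_mult)
qed (simp add: burkholder_def)

lemma integrand_burkholder:
  assumes "1 \<le> q"
  shows "integrand (burkholder q)"
proof -
  have c: "continuous_on UNIV (\<lambda>A :: real^2^2. opnorm A)"
    unfolding opnorm_conformal by (intro continuous_intros continuous_on_conformal_norm)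
  have [measurable]: "(\<lambda>A :: real^2^2. opnorm A) \<in> borel_measurable borel"
    "(det :: real^2^2 \<Rightarrow> real) \<in> borel_measurable borel"
    using c continuous_on_det2 borel_measurable_continuous_onI by auto
  have "burkholder q \<in> borel_measurable borel"
    unfolding burkholder_def[abs_def] by measurable
  moreover have "bounded (burkholder q ` ball A 1)" for A
  proof -
    obtain M where M: "\<forall>y\<in>(\<lambda>X :: real^2^2. opnorm X) ` cball A 1. norm y \<le> M"
      using integrand_bounded_on_compact[OF integrand_continuous[OF c] compact_cball[of A 1]]
      unfolding bounded_iff by blast
    have "norm (burkholder q X) \<le> 2 * M powr q" if "X \<in> ball A 1" for X
    proof -
      have "opnorm X \<le> M" using bspec[OF M imageI, of X] that by simp
      then have "opnorm X powr q \<le> M powr q"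
        using assms onorm_pos_le[of "(*v) X"] by (intro powr_mono2) auto
      then show ?thesis using abs_burkholder_le[OF assms, of X] by simp
    qed
    then show ?thesis unfolding bounded_iff by blast
  qed
  ultimately show ?thesis
    using zero_less_one unfolding integrand_def by metis
qed

section \<open>Left multiplication of fields and gradients by a constant matrix\<close>

lemma bounded_linear_matrix_mult_right: "bounded_linear (\<lambda>X :: real^'n^'m. (P :: real^'m^'k) ** X)"
  unfolding linear_conv_bounded_linear[symmetric]
  by (intro linearI) (simp_all add: vec_eq_iff matrix_matrix_mult_def
      distrib_left sum.distrib sum_distrib_left mult_ac)

lemma matrix_mult_scaleR_right: "P ** (c *\<^sub>R X) = c *\<^sub>R (P ** (X :: real^'n^'m))"
  by (rule linear_scale[OF bounded_linear.linear[OF bounded_linear_matrix_mult_right]])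

lemma jacobian_matrix_vector_mult:
  fixes \<psi> :: "real^'n \<Rightarrow> real^'m" and P :: "real^'m^'k"
  assumes "\<psi> differentiable at x"
  shows "jacobian (\<lambda>x. P *v \<psi> x) (at x) = P ** jacobian \<psi> (at x)"
  using frechet_derivative_bounded_linear_compose[OF matrix_vector_mul_bounded_linear assms, of P]
  by (simp add: jacobian_def matrix_def matrix_matrix_mult_def matrix_vector_mult_def vec_eq_iff)

lemma tendsto_integral_norm_bounded_linear:
  fixes J :: "nat \<Rightarrow> 'a \<Rightarrow> 'b::euclidean_space" and L :: "'b \<Rightarrow> 'c::euclidean_space"
  assumes "\<And>k. integrable M (J k)" "integrable M D"
    and lim: "(\<lambda>k. \<integral>x. norm (J k x - D x) \<partial>M) \<longlonglongrightarrow> 0" and L: "bounded_linear L"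
  shows "(\<lambda>k. \<integral>x. norm (L (J k x) - L (D x)) \<partial>M) \<longlonglongrightarrow> 0"
proof -
  obtain K where K: "0 < K" "\<And>x. norm (L x) \<le> norm x * K"
    using bounded_linear.pos_bounded[OF L] by blast
  have "norm (\<integral>x. norm (L (J k x) - L (D x)) \<partial>M) \<le> K * (\<integral>x. norm (J k x - D x) \<partial>M)" for k
  proof -
    have i: "integrable M (\<lambda>x. J k x - D x)" using assms by simp
    have "(\<integral>x. norm (L (J k x) - L (D x)) \<partial>M) = (\<integral>x. norm (L (J k x - D x)) \<partial>M)"
      using bounded_linear.linear[OF L] by (simp add: linear_diff)
    also have "\<dots> \<le> (\<integral>x. K * norm (J k x - D x) \<partial>M)"
      using K(2) i
      by (intro integral_mono integrable_norm integrable_bounded_linear[OF L] integrable_mult_right)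
        (auto simp: mult.commute)
    finally show ?thesis by simp
  qed
  then show ?thesis
    by (intro Lim_null_comparison[OF always_eventually[OF allI] tendsto_mult_right_zero[OF lim, of K]])
qed

text \<open>Each identity for the product is a linear combination of those for the components; the
  integrability assumptions allow the finite sum to be exchanged with the integral.\<close>

lemma weak_gradient_matrix_mult:
  fixes P :: "real^'m^'k"
  assumes "weak_gradient \<Omega> \<phi> D" "integrable (lebesgue_on \<Omega>) \<phi>" "integrable (lebesgue_on \<Omega>) D"
    and "open \<Omega>"
  shows "weak_gradient \<Omega> (\<lambda>x. P *v \<phi> x) (\<lambda>x. P ** D x)"
  unfolding weak_gradient_def
proof (intro ballI allI)
  fix \<psi> :: "real^'a \<Rightarrow> real" and i j assume \<psi>: "\<psi> \<in> test_functions \<Omega>"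
  let ?M = "lebesgue_on \<Omega>" and ?d = "\<lambda>x. frechet_derivative \<psi> (at x) (axis j 1)"
  have d: "?d \<in> test_functions \<Omega>"
    by (intro test_functions_frechet_derivative \<psi>) (simp add: axis_in_Basis_iff)
  have prod: "integrable ?M (\<lambda>x. f x * \<eta> x)"
    if \<eta>: "\<eta> \<in> test_functions \<Omega>" and f: "integrable ?M f" for \<eta> f :: "real^'a \<Rightarrow> real"
  proof -
    obtain C where "\<And>x. \<bar>\<eta> x\<bar> \<le> C" using test_functions_dominated[OF \<eta>] by auto
    then have "integrable ?M (\<lambda>x. \<eta> x * f x)"
      using test_functions_lebesgue_on(1)[OF \<eta> assms(4)]
      by (intro integrable_bounded_mult[where C=C] f) auto
    then show ?thesis by (simp add: mult.commute)
  qed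
  have i\<phi>: "integrable ?M (\<lambda>x. \<phi> x $ l * ?d x)" for l
    by (intro prod d integrable_bounded_linear[OF bounded_linear_vec_nth assms(2)])
  have iD: "integrable ?M (\<lambda>x. D x $ l $ j * \<psi> x)" for l
    by (intro prod \<psi> integrable_bounded_linear[OF bounded_linear_matrix_nth assms(3)])
  have "(\<integral>x. (P *v \<phi> x) $ i * ?d x \<partial>?M) = (\<integral>x. (\<Sum>l\<in>UNIV. P $ i $ l * (\<phi> x $ l * ?d x)) \<partial>?M)"
    by (simp add: matrix_vector_mult_def sum_distrib_right mult.assoc)
  also have "\<dots> = (\<Sum>l\<in>UNIV. P $ i $ l * (\<integral>x. \<phi> x $ l * ?d x \<partial>?M))"
    using i\<phi> by simp
  also have "\<dots> = (\<Sum>l\<in>UNIV. - (P $ i $ l * (\<integral>x. D x $ l $ j * \<psi> x \<partial>?M)))"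
    using assms(1) \<psi> unfolding weak_gradient_def by simp
  also have "\<dots> = - (\<integral>x. (\<Sum>l\<in>UNIV. P $ i $ l * (D x $ l $ j * \<psi> x)) \<partial>?M)"
    using iD by (simp add: sum_negf)
  also have "\<dots> = - (\<integral>x. (P ** D x) $ i $ j * \<psi> x \<partial>?M)"
    by (simp add: matrix_matrix_mult_def sum_distrib_right mult.assoc)
  finally show "(\<integral>x. (P *v \<phi> x) $ i * ?d x \<partial>?M) = - (\<integral>x. (P ** D x) $ i $ j * \<psi> x \<partial>?M)" .
qed

lemma W01_inf_matrix_mult:
  fixes P :: "real^'m^'k"
  assumes W: "W01_inf \<Omega> \<phi> D" and \<Omega>: "open \<Omega>"
  shows "W01_inf \<Omega> (\<lambda>x. P *v \<phi> x) (\<lambda>x. P ** D x)"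
proof -
  let ?M = "lebesgue_on \<Omega>"
  have W11: "W01_1 \<Omega> \<phi> D" and bd: "Linfty \<Omega> \<phi>" "Linfty \<Omega> D" and wg: "weak_gradient \<Omega> \<phi> D"
    and int: "integrable ?M \<phi>" "integrable ?M D"
    using W unfolding W01_inf_def W1_inf_def W01_1_def by auto
  note L = matrix_vector_mul_bounded_linear[of P] bounded_linear_matrix_mult_right[of P]
  have wg': "weak_gradient \<Omega> (\<lambda>x. P *v \<phi> x) (\<lambda>x. P ** D x)"
    by (rule weak_gradient_matrix_mult[OF wg int \<Omega>])
  obtain \<psi> where "\<forall>k. \<psi> k \<in> test_functions \<Omega>"
    and lim: "(\<lambda>k. \<integral>x. norm (\<psi> k x - \<phi> x) \<partial>?M) \<longlonglongrightarrow> 0"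
      "(\<lambda>k. \<integral>x. norm (jacobian (\<psi> k) (at x) - D x) \<partial>?M) \<longlonglongrightarrow> 0"
    using W01_1_approximation[OF W11] by blast
  then have \<psi>: "\<psi> k \<in> test_functions \<Omega>" for k by blast
  have "(\<lambda>k. (\<integral>x. norm (P *v \<psi> k x - P *v \<phi> x) \<partial>?M)
      + (\<integral>x. norm (P ** jacobian (\<psi> k) (at x) - P ** D x) \<partial>?M)) \<longlonglongrightarrow> 0 + 0"
    by (rule tendsto_add[OF
          tendsto_integral_norm_bounded_linear[OF test_functions_lebesgue_on(1)[OF \<psi> \<Omega>] int(1) lim(1) L(1)]
          tendsto_integral_norm_bounded_linear[OF test_functions_jacobian_integrable[OF \<psi> \<Omega>] int(2) lim(2) L(2)]])
  then have "(\<lambda>k. (\<integral>x. norm (P *v \<psi> k x - P *v \<phi> x) \<partial>?M)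
      + (\<integral>x. norm (jacobian (\<lambda>x. P *v \<psi> k x) (at x) - P ** D x) \<partial>?M)) \<longlonglongrightarrow> 0"
    by (simp add: jacobian_matrix_vector_mult[OF test_functions_differentiable[OF \<psi>]])
  moreover have "(\<lambda>x. P *v \<psi> k x) \<in> test_functions \<Omega>" for k
    by (rule test_functions_bounded_linear_compose[OF L(1) \<psi>])
  ultimately have "W01_1 \<Omega> (\<lambda>x. P *v \<phi> x) (\<lambda>x. P ** D x)"
    unfolding W01_1_def
    using wg' integrable_bounded_linear[OF L(1) int(1)] integrable_bounded_linear[OF L(2) int(2)]
    by (intro conjI exI[of _ "\<lambda>k x. P *v \<psi> k x"]) auto
  then show ?thesis
    unfolding W01_inf_def W1_inf_def
    using wg' Linfty_bounded_linear[OF L(1) bd(1)] Linfty_bounded_linear[OF L(2) bd(2)] by blast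
qed

text \<open>Replacing a field by its image under \<open>P\<close> keeps it admissible and multiplies
  its gradient by \<open>P\<close>. Undoing this inside F by the inverse \<open>P'\<close> moves the
  base point from A to \<open>P ** A\<close>.\<close>

lemma quasiconvex_at_matrix_mult:
  fixes P P' :: "real^'n^'n" and F :: "real^'n^'n \<Rightarrow> real"
  assumes "open \<Omega>" "P' ** P = mat 1" "quasiconvex_at \<Omega> (\<lambda>X. F (P' ** X)) (P ** A)"
  shows "quasiconvex_at \<Omega> F A"
  unfolding quasiconvex_at_def
proof (intro allI impI)
  fix \<phi> :: "real^'n \<Rightarrow> real^'n" and D assume "W01_inf \<Omega> \<phi> D"
  then have "W01_inf \<Omega> (\<lambda>x. P *v \<phi> x) (\<lambda>x. P ** D x)"
    by (rule W01_inf_matrix_mult[OF _ assms(1)])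
  then have "F (P' ** (P ** A)) \<le>
      1 / measure lebesgue \<Omega> * (\<integral>x. F (P' ** (P ** A + P ** D x)) \<partial>lebesgue_on \<Omega>)"
    using assms(3) unfolding quasiconvex_at_def by blast
  moreover have "P' ** (P ** X) = X" for X :: "real^'n^'n"
    using assms(2) by (simp add: matrix_mul_assoc)
  ultimately show "F A \<le> 1 / measure lebesgue \<Omega> * (\<integral>x. F (A + D x) \<partial>lebesgue_on \<Omega>)"
    by (simp flip: matrix_add_ldistrib)
qed

section \<open>From multiples of the identity to all conformal matrices\<close>

lemma quasiconvex_at_conformal:
  fixes F :: "real^2^2 \<Rightarrow> real"
  assumes \<Omega>: "bounded_domain \<Omega>" and F: "integrand F" "\<forall>A. 0 \<le> F A" "isotropic F"
    "rank_one_convex F" "positively_homogeneous p F"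
    and p: "1 \<le> p" "(p \<le> 2 \<and> (\<forall>q\<ge>1. \<forall>A. quasiconvex_at \<Omega> (burkholder q) A)) \<or> 2 \<le> p"
    and t: "0 < t"
  shows "quasiconvex_at \<Omega> F (mat t)"
  using p(2)
proof (elim disjE conjE)
  assume "p \<le> 2" and B: "\<forall>q\<ge>1. \<forall>A. quasiconvex_at \<Omega> (burkholder q) A"
  have "mat t = t *\<^sub>R (mat 1 :: real^2^2)" by (simp add: mat2_mat mat2_scaleR)
  then have "F (mat t) = t powr p * F (mat 1)"
    using F(5) t unfolding positively_homogeneous_def by simp
  then have "F (mat t) = F (mat 1) * (p / 2) * burkholder p (mat t)"
    using burkholder_conformal[OF p(1) \<open>p \<le> 2\<close> t] by simp
  then show ?thesis
    using B p(1) F(2) burkholder_lower_bound[OF F(3,4,5,2) p(1) \<open>p \<le> 2\<close>]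
    by (intro quasiconvex_at_lower_bound[OF \<Omega> F(1) integrand_burkholder[OF p(1)],
          where k="F (mat 1) * (p / 2)"]) auto
next
  assume "2 \<le> p"
  \<comment> \<open>The tangent at r = 1 of r^(p/2), where r = det X / t^2, written as an affine
    function of \<open>det X\<close>.\<close>
  let ?G = "\<lambda>X :: real^2^2. (1 - p / 2) + p / (2 * t\<^sup>2) * det X"
  have G: "?G X = 1 + p / 2 * (det X / t\<^sup>2 - 1)" for X
    using t by (simp add: field_simps)
  have "det (mat t :: real^2^2) = t\<^sup>2" by (simp add: det_2 mat2_mat power2_eq_square)
  then have "?G (mat t) = 1" unfolding G using t by simp
  then have eq: "F (mat t) = F (mat t) * ?G (mat t)" by (simp only: mult_1_right)
  have int: "integrand ?G"
    by (intro integrand_continuous continuous_intros continuous_on_det2)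
  have le: "F (mat t) * ?G X \<le> F X" for X
    unfolding G by (rule polyconvex_lower_bound[OF F(3,4,5,2) \<open>2 \<le> p\<close> t])
  show ?thesis
    by (rule quasiconvex_at_lower_bound[OF \<Omega> F(1) int quasiconvex_at_det[OF \<Omega>] _ le eq])
      (simp add: F(2))
qed

text \<open>Multiplication by the transpose of \<open>Q\<close> moves the base point to
  \<open>mat t\<close>, and isotropy makes the transformed integrand equal to F.\<close>

lemma quasiconvex_at_rotation:
  fixes F :: "real^2^2 \<Rightarrow> real"
  assumes \<Omega>: "bounded_domain \<Omega>" and F: "integrand F" "\<forall>A. 0 \<le> F A" "isotropic F"
    "rank_one_convex F" "positively_homogeneous p F"
    and p: "1 \<le> p" "(p \<le> 2 \<and> (\<forall>q\<ge>1. \<forall>A. quasiconvex_at \<Omega> (burkholder q) A)) \<or> 2 \<le> p"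
    and t: "0 < t" and Q: "rotation_matrix Q"
  shows "quasiconvex_at \<Omega> F (t *\<^sub>R Q)"
proof -
  have Q': "transpose Q ** Q = mat 1" "Q ** transpose Q = mat 1"
    using Q unfolding rotation_matrix_def orthogonal_matrix_def by auto
  have A: "transpose Q ** (t *\<^sub>R Q) = mat t"
    unfolding matrix_mult_scaleR_right Q'(1) by (simp add: mat2_mat mat2_scaleR)
  have "rotation_matrix (mat 1 :: real^2^2)"
    by (simp add: rotation_matrix_def orthogonal_matrix_id)
  then have "F (Q ** X ** mat 1) = F X" for X
    using F(3) Q unfolding isotropic_def by blast
  then have "quasiconvex_at \<Omega> (\<lambda>X. F (Q ** X)) (transpose Q ** (t *\<^sub>R Q))"
    unfolding A matrix_mul_rid by (simp add: quasiconvex_at_conformal[OF assms(1-9)])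
  moreover have "open \<Omega>" using \<Omega> unfolding bounded_domain_def by simp
  ultimately show ?thesis
    using quasiconvex_at_matrix_mult[OF _ Q'(2)] by blast
qed

lemma integrand_matrix_mult:
  fixes F :: "real^'n^'n \<Rightarrow> real"
  assumes "integrand F"
  shows "integrand (\<lambda>X. F (P ** X))"
proof -
  have c: "continuous_on S (\<lambda>X :: real^'n^'n. P ** X)" for S
    by (rule linear_continuous_on[OF bounded_linear_matrix_mult_right])
  have "F \<in> borel_measurable borel" using assms unfolding integrand_def by blast
  then have "(\<lambda>X. F (P ** X)) \<in> borel_measurable borel"
    by (rule measurable_compose[OF borel_measurable_continuous_onI[OF c]])
  moreover have "bounded ((\<lambda>X. F (P ** X)) ` ball X 1)" for X
  proof -
    have "bounded (F ` ((**) P ` cball X 1))"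
      by (intro integrand_bounded_on_compact[OF assms] compact_continuous_image c compact_cball)
    then show ?thesis by (rule bounded_subset) auto
  qed
  ultimately show ?thesis using zero_less_one unfolding integrand_def by blast
qed

text \<open>An invertible factor preserves rank: multiplication by \<open>P\<close> cannot raise it,
  and multiplication by \<open>P'\<close> cannot raise it on the way back.\<close>

lemma rank_one_convex_matrix_mult:
  fixes F :: "real^'n^'n \<Rightarrow> real"
  assumes "rank_one_convex F" "P' ** P = mat 1"
  shows "rank_one_convex (\<lambda>X. F (P ** X))"
  unfolding rank_one_convex_def
proof (intro allI impI)
  fix A X :: "real^'n^'n" assume X: "rank X = 1"
  have "P' ** (P ** X) = X" using assms(2) by (simp add: matrix_mul_assoc)
  then have "rank (P ** X) = 1"
    using X rank_mul_le_right[of P X] rank_mul_le_right[of P' "P ** X"] by simp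
  then have "convex_on UNIV (\<lambda>t. F (P ** A + t *\<^sub>R (P ** X)))"
    using assms(1) unfolding rank_one_convex_def by blast
  then show "convex_on UNIV (\<lambda>t. F (P ** (A + t *\<^sub>R X)))"
    by (simp only: matrix_add_ldistrib matrix_mult_scaleR_right)
qed

text \<open>Conjugation by the involution \<open>J\<close> maps rotations to rotations, so
  \<open>J\<close> can be moved past the left rotation.\<close>

lemma isotropic_reflection:
  fixes F :: "real^'n^'n \<Rightarrow> real"
  assumes "isotropic F" "orthogonal_matrix J" "J ** J = mat 1"
  shows "isotropic (\<lambda>X. F (J ** X))"
  unfolding isotropic_def
proof (intro allI impI)
  fix X S T :: "real^'n^'n" assume S: "rotation_matrix S" and T: "rotation_matrix T"
  have "det J * det J = 1" using assms(3) by (metis det_I det_mul)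
  then have "rotation_matrix (J ** S ** J)"
    using S assms(2) unfolding rotation_matrix_def by (simp add: orthogonal_matrix_mul det_mul)
  then have "F (J ** S ** J ** (J ** X) ** T) = F (J ** X)"
    using assms(1) T unfolding isotropic_def by blast
  moreover have "J ** S ** J ** (J ** X) = J ** S ** (J ** J) ** X"
    by (simp only: matrix_mul_assoc)
  ultimately show "F (J ** (S ** X ** T)) = F (J ** X)"
    unfolding assms(3) matrix_mul_rid by (simp only: matrix_mul_assoc)
qed

theorem theorem1p2:
  fixes F :: "real^2^2 \<Rightarrow> real" and p :: real and \<Omega> :: "(real^2) set"
  assumes "bounded_domain \<Omega>"
    and "integrand F" and "\<forall>A. 0 \<le> F A"
    and "isotropic F" and "rank_one_convex F"
    and "p > 1" and "positively_homogeneous p F"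
    and "(p \<le> 2 \<and> (\<forall>q\<ge>1. \<forall>A. quasiconvex_at \<Omega> (burkholder q) A)) \<or> p \<ge> 2"
  shows "\<forall>A\<in>CO. quasiconvex_at \<Omega> F A"
proof
  fix A :: "real^2^2" assume "A \<in> CO"
  then obtain t Q where A: "A = t *\<^sub>R Q" and Q: "orthogonal_matrix Q" unfolding CO_def by blast
  have p: "1 \<le> p" using assms(6) by simp
  show "quasiconvex_at \<Omega> F A"
  proof (cases "t = 0")
    case True
    \<comment> \<open>Scaling the zero matrix by 2 forces F(0) = 0, and a mean of the nonnegative F
      is never below that.\<close>
    have "F (2 *\<^sub>R 0) = 2 powr p * F 0"
      using assms(7) zero_less_numeral unfolding positively_homogeneous_def by blast
    then have "(2 powr p - 1) * F 0 = 0" unfolding scaleR_zero_right left_diff_distrib by linarith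
    moreover have "2 powr p \<noteq> (1 :: real)" using assms(6) by (simp add: powr_eq_one_iff)
    ultimately have "F A = 0" using True A by simp
    then show ?thesis
      using assms(3) unfolding quasiconvex_at_def by simp
  next
    case False
    \<comment> \<open>Homogeneity concerns positive factors only, so the sign of \<open>t\<close> is
      moved into the orthogonal matrix.\<close>
    define R where "R = sgn t *\<^sub>R Q"
    have R: "A = \<bar>t\<bar> *\<^sub>R R" "0 < \<bar>t\<bar>"
      using False by (simp_all add: A R_def abs_mult_sgn mult.commute)
    have "transpose (- Q) ** (- Q) = transpose Q ** Q"
      by (simp add: transpose_def matrix_matrix_mult_def vec_eq_iff)
    then have oR: "orthogonal_matrix R"
      using Q False unfolding R_def orthogonal_matrix by (cases "t > 0") simp_all
    show ?thesis
    proof (cases "det R = 1")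
      case True
      then have "rotation_matrix R" using oR unfolding rotation_matrix_def by simp
      then show ?thesis
        unfolding R(1) by (rule quasiconvex_at_rotation[OF assms(1-5,7) p assms(8) R(2)])
    next
      case False
      then have "det R = - 1" using det_orthogonal_matrix[OF oR] by blast
      \<comment> \<open>A reflection that is its own inverse: \<open>J ** R\<close> has determinant
        1, and composing F with \<open>J\<close> preserves every assumption on F.\<close>
      define J where "J = mat2 1 0 0 (- 1)"
      have J: "J ** J = mat 1" "orthogonal_matrix J" "det J = - 1"
        by (simp_all add: J_def mat2_mult mat2_mat det_2 orthogonal_matrix transpose_mat2)
      let ?F = "\<lambda>X. F (J ** X)"
      have nonneg: "\<forall>X. 0 \<le> ?F X" using assms(3) by blast
      have hom: "positively_homogeneous p ?F"
        using assms(7) unfolding positively_homogeneous_def matrix_mult_scaleR_right by blast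
      have "rotation_matrix (J ** R)"
        using oR J \<open>det R = - 1\<close> unfolding rotation_matrix_def
        by (simp add: orthogonal_matrix_mul det_mul)
      then have "quasiconvex_at \<Omega> ?F (J ** (\<bar>t\<bar> *\<^sub>R R))"
        unfolding matrix_mult_scaleR_right
        by (rule quasiconvex_at_rotation[OF assms(1) integrand_matrix_mult[OF assms(2)] nonneg
              isotropic_reflection[OF assms(4) J(2,1)] rank_one_convex_matrix_mult[OF assms(5) J(1)]
              hom p assms(8) R(2)])
      moreover have "open \<Omega>" using assms(1) unfolding bounded_domain_def by simp
      ultimately show ?thesis
        unfolding R(1) using quasiconvex_at_matrix_mult[OF _ J(1)] by blast
    qed
  qed
qed

end
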